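(* Let $\mathbb{F}=\mathbb{Z}/2$ and let $E=\mathbb{F}[x_0,x_1,x_2,\dotsc]/(x_i^2\mid i\ge 0)$ be the exterior algebra over $\mathbb{F}$ with one generator $x_i\in E_{2^i}$ for each $i\in\mathbb{N}$. Then $E$ is self-injective and coherent. The reduced quotient is $E/\sqrt{0}=\mathbb{F}$.
   Context: Rings are $\mathbb{Z}$-graded, unital and commutative in the graded sense. Modules are graded, and ``element'' and ``ideal'' mean homogeneous element and homogeneous ideal. $\mathbb{N}=\{0,1,2,\dotsc\}$. A graded ring $R$ is self-injective if $R$ is an injective object in the category of graded $R$-modules. A finitely generated free module is one of the form $\bigoplus_{i=1}^r\Sigma^{d_i}R$ (arbitrary degree shifts $d_i$ allowed). A module $M$ is finitely presented if there is an exact sequence $P_1\to P_0\to M\to 0$ with $P_0,P_1$ finitely generated free. $R$ is coherent if every finitely generated ideal is finitely presented. $\sqrt{0}$ is the ideal of nilpotent elements. *)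

theory Defs
  imports "HOL-Algebra.Algebra" "HOL-Algebra.Algebraic_Closure_Type"
    "HOL-Library.Poly_Mapping" "HOL-Library.Z2"
begin

section \<open>Graded rings and graded modules\<close>

text \<open>
  Graded objects are encoded internally: a ring or module together with the family of its
  homogeneous parts, of which it is the direct sum.
\<close>

definition direct_sum_grading :: "('a, 'e) ring_scheme \<Rightarrow> (int \<Rightarrow> 'a set) \<Rightarrow> bool" where
  "direct_sum_grading A G \<longleftrightarrow>
    (\<forall>d. additive_subgroup (G d) A) \<and>
    (\<forall>x \<in> carrier A. \<exists>!c. (\<forall>d. c d \<in> G d) \<and> finite {d. c d \<noteq> \<zero>\<^bsub>A\<^esub>} \<and>
        x = (\<Oplus>\<^bsub>A\<^esub>d\<in>{d. c d \<noteq> \<zero>\<^bsub>A\<^esub>}. c d))"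

locale graded_ring = ring R for R :: "('a, 'r) ring_scheme" (structure) +
  fixes G :: "int \<Rightarrow> 'a set"
  assumes ring_grading: "direct_sum_grading R G"
    and one_homogeneous: "\<one> \<in> G 0"
    and mult_homogeneous: "\<lbrakk>a \<in> G d; b \<in> G e\<rbrakk> \<Longrightarrow> a \<otimes> b \<in> G (d + e)"
    and graded_commute: "\<lbrakk>a \<in> G d; b \<in> G e\<rbrakk> \<Longrightarrow>
      a \<otimes> b = (if odd d \<and> odd e then \<ominus> (b \<otimes> a) else b \<otimes> a)"

text \<open>
  The module axioms are those of the library locale \<^locale>\<open>module\<close>, which cannot be used
  directly since it requires strict commutativity of the ring.
\<close>

locale graded_module = graded_ring R G + M?: abelian_group M
  for R :: "('a, 'r) ring_scheme" (structure) and G :: "int \<Rightarrow> 'a set"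
    and M :: "('a, 'm) module" (structure) +
  fixes H :: "int \<Rightarrow> 'm set"
  assumes smult_closed: "\<lbrakk>a \<in> carrier R; x \<in> carrier M\<rbrakk> \<Longrightarrow> a \<odot>\<^bsub>M\<^esub> x \<in> carrier M"
    and smult_l_distr: "\<lbrakk>a \<in> carrier R; b \<in> carrier R; x \<in> carrier M\<rbrakk> \<Longrightarrow>
      (a \<oplus>\<^bsub>R\<^esub> b) \<odot>\<^bsub>M\<^esub> x = a \<odot>\<^bsub>M\<^esub> x \<oplus>\<^bsub>M\<^esub> b \<odot>\<^bsub>M\<^esub> x"
    and smult_r_distr: "\<lbrakk>a \<in> carrier R; x \<in> carrier M; y \<in> carrier M\<rbrakk> \<Longrightarrow>
      a \<odot>\<^bsub>M\<^esub> (x \<oplus>\<^bsub>M\<^esub> y) = a \<odot>\<^bsub>M\<^esub> x \<oplus>\<^bsub>M\<^esub> a \<odot>\<^bsub>M\<^esub> y"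
    and smult_assoc1: "\<lbrakk>a \<in> carrier R; b \<in> carrier R; x \<in> carrier M\<rbrakk> \<Longrightarrow>
      (a \<otimes>\<^bsub>R\<^esub> b) \<odot>\<^bsub>M\<^esub> x = a \<odot>\<^bsub>M\<^esub> (b \<odot>\<^bsub>M\<^esub> x)"
    and smult_one: "x \<in> carrier M \<Longrightarrow> \<one>\<^bsub>R\<^esub> \<odot>\<^bsub>M\<^esub> x = x"
    and module_grading: "direct_sum_grading M H"
    and smult_homogeneous: "\<lbrakk>a \<in> G d; x \<in> H e\<rbrakk> \<Longrightarrow> a \<odot>\<^bsub>M\<^esub> x \<in> H (d + e)"

text \<open>Morphisms of graded modules preserve degrees; their values off the carrier are irrelevant.\<close>

definition graded_hom ::
  "('a, 'r) ring_scheme \<Rightarrow> ('a, 'm) module \<Rightarrow> (int \<Rightarrow> 'm set) \<Rightarrow>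
    ('a, 'n) module \<Rightarrow> (int \<Rightarrow> 'n set) \<Rightarrow> ('m \<Rightarrow> 'n) set" where
  "graded_hom R M H N K = {h \<in> carrier M \<rightarrow> carrier N.
     (\<forall>x \<in> carrier M. \<forall>y \<in> carrier M. h (x \<oplus>\<^bsub>M\<^esub> y) = h x \<oplus>\<^bsub>N\<^esub> h y) \<and>
     (\<forall>a \<in> carrier R. \<forall>x \<in> carrier M. h (a \<odot>\<^bsub>M\<^esub> x) = a \<odot>\<^bsub>N\<^esub> h x) \<and>
     (\<forall>d. h ` H d \<subseteq> K d)}"

text \<open>
  The zero, addition and scalar multiplication of \<open>R\<close> restricted to \<open>I\<close>. The multiplicative
  fields \<open>mult\<close> and \<open>one\<close> of a module record carry no meaning, here and below.
\<close>

definition ideal_module :: "('a, 'r) ring_scheme \<Rightarrow> 'a set \<Rightarrow> ('a, 'a) module" where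
  "ideal_module R I = \<lparr>carrier = I, monoid.mult = monoid.mult R, one = \<one>\<^bsub>R\<^esub>, ring.zero = \<zero>\<^bsub>R\<^esub>, add = add R,
     module.smult = monoid.mult R\<rparr>"

section \<open>Self-injectivity\<close>

text \<open>
  The modules tested against range over the two types given by the type arguments. With type
  variables as arguments, a theorem covers modules over arbitrary types.
\<close>

definition graded_injective ::
  "'m itself \<Rightarrow> 'n itself \<Rightarrow> ('a, 'r) ring_scheme \<Rightarrow> (int \<Rightarrow> 'a set) \<Rightarrow>
    ('a, 'q) module \<Rightarrow> (int \<Rightarrow> 'q set) \<Rightarrow> bool" where
  "graded_injective tm tn R G Q L \<longleftrightarrow> graded_module R G Q L \<and>
     (\<forall>(M :: ('a, 'm) module) H (N :: ('a, 'n) module) K i f.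
        graded_module R G M H \<and> graded_module R G N K \<and>
        i \<in> graded_hom R M H N K \<and> inj_on i (carrier M) \<and> f \<in> graded_hom R M H Q L \<longrightarrow>
        (\<exists>g \<in> graded_hom R N K Q L. \<forall>x \<in> carrier M. g (i x) = f x))"

definition graded_self_injective ::
  "'m itself \<Rightarrow> 'n itself \<Rightarrow> ('a, 'r) ring_scheme \<Rightarrow> (int \<Rightarrow> 'a set) \<Rightarrow> bool" where
  "graded_self_injective tm tn R G \<longleftrightarrow>
     graded_injective tm tn R G (ideal_module R (carrier R)) G"

section \<open>Finite presentation and coherence\<close>

text \<open>
  For \<open>ds = [d\<^sub>1, \<dots>, d\<^sub>r]\<close> this is \<open>\<Sigma>\<^bsup>d\<^sub>1\<^esup> R \<oplus> \<dots> \<oplus> \<Sigma>\<^bsup>d\<^sub>r\<^esup> R\<close>, where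
  \<open>\<Sigma>\<^bsup>d\<^esup> R\<close> has \<open>G (k - d)\<close> in degree \<open>k\<close>.
\<close>

definition free_module :: "('a, 'r) ring_scheme \<Rightarrow> int list \<Rightarrow> ('a, nat \<Rightarrow> 'a) module" where
  "free_module R ds =
    \<lparr>carrier = {..<length ds} \<rightarrow>\<^sub>E carrier R,
     monoid.mult = (\<lambda>v w. \<lambda>i\<in>{..<length ds}. v i \<otimes>\<^bsub>R\<^esub> w i),
     one = (\<lambda>i\<in>{..<length ds}. \<one>\<^bsub>R\<^esub>),
     ring.zero = (\<lambda>i\<in>{..<length ds}. \<zero>\<^bsub>R\<^esub>),
     add = (\<lambda>v w. \<lambda>i\<in>{..<length ds}. v i \<oplus>\<^bsub>R\<^esub> w i),
     module.smult = (\<lambda>a v. \<lambda>i\<in>{..<length ds}. a \<otimes>\<^bsub>R\<^esub> v i)\<rparr>"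

definition free_grading :: "(int \<Rightarrow> 'a set) \<Rightarrow> int list \<Rightarrow> int \<Rightarrow> (nat \<Rightarrow> 'a) set" where
  "free_grading G ds k = (\<Pi>\<^sub>E i\<in>{..<length ds}. G (k - ds ! i))"

definition finitely_presented ::
  "('a, 'r) ring_scheme \<Rightarrow> (int \<Rightarrow> 'a set) \<Rightarrow> ('a, 'm) module \<Rightarrow> (int \<Rightarrow> 'm set) \<Rightarrow> bool" where
  "finitely_presented R G M H \<longleftrightarrow> graded_module R G M H \<and>
     (\<exists>ds es p q.
        p \<in> graded_hom R (free_module R es) (free_grading G es)
                         (free_module R ds) (free_grading G ds) \<and>
        q \<in> graded_hom R (free_module R ds) (free_grading G ds) M H \<and>
        p ` carrier (free_module R es) = {v \<in> carrier (free_module R ds). q v = \<zero>\<^bsub>M\<^esub>} \<and>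
        q ` carrier (free_module R ds) = carrier M)"

definition graded_coherent :: "('a, 'r) ring_scheme \<Rightarrow> (int \<Rightarrow> 'a set) \<Rightarrow> bool" where
  "graded_coherent R G \<longleftrightarrow> graded_ring R G \<and>
     (\<forall>S. finite S \<and> S \<subseteq> (\<Union>d. G d) \<longrightarrow>
        finitely_presented R G (ideal_module R (Idl\<^bsub>R\<^esub> S)) (\<lambda>d. Idl\<^bsub>R\<^esub> S \<inter> G d))"

section \<open>Quotients and isomorphisms\<close>

definition nilradical :: "('a, 'r) ring_scheme \<Rightarrow> 'a set" where
  "nilradical R = {a \<in> carrier R. \<exists>n::nat. a [^]\<^bsub>R\<^esub> n = \<zero>\<^bsub>R\<^esub>}"

definition quotient_grading ::
  "('a, 'r) ring_scheme \<Rightarrow> 'a set \<Rightarrow> (int \<Rightarrow> 'a set) \<Rightarrow> int \<Rightarrow> 'a set set" where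
  "quotient_grading R I G d = (\<lambda>a. I +>\<^bsub>R\<^esub> a) ` G d"

definition concentrated_grading :: "('a, 'r) ring_scheme \<Rightarrow> int \<Rightarrow> 'a set" where
  "concentrated_grading R d = (if d = 0 then carrier R else {\<zero>\<^bsub>R\<^esub>})"

definition graded_ring_iso ::
  "('a, 'r) ring_scheme \<Rightarrow> (int \<Rightarrow> 'a set) \<Rightarrow> ('b, 's) ring_scheme \<Rightarrow> (int \<Rightarrow> 'b set) \<Rightarrow>
    ('a \<Rightarrow> 'b) set" where
  "graded_ring_iso R G S H = {h \<in> ring_iso R S. \<forall>d. h ` G d = H d}"

section \<open>The exterior algebra over the field with two elements\<close>

abbreviation F2 :: "bit ring" where
  "F2 \<equiv> ring_of_type_algebra"

text \<open>
  A monomial \<open>m :: nat \<Rightarrow>\<^sub>0 nat\<close> is its exponent function, so this type is the polynomial ring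
  over the two-element field in the variables \<open>x\<^sub>0, x\<^sub>1, x\<^sub>2, \<dots>\<close>.
\<close>

type_synonym f2_poly = "(nat \<Rightarrow>\<^sub>0 nat) \<Rightarrow>\<^sub>0 bit"

abbreviation poly_F2 :: "f2_poly ring" where
  "poly_F2 \<equiv> ring_of_type_algebra"

definition poly_var :: "nat \<Rightarrow> f2_poly" where
  "poly_var i = Poly_Mapping.single (Poly_Mapping.single i 1) 1"

definition monomial_degree :: "(nat \<Rightarrow>\<^sub>0 nat) \<Rightarrow> int" where
  "monomial_degree m = (\<Sum>i\<in>Poly_Mapping.keys m. int (Poly_Mapping.lookup m i) * 2 ^ i)"

definition poly_grading :: "int \<Rightarrow> f2_poly set" where
  "poly_grading d = {p. \<forall>m \<in> Poly_Mapping.keys p. monomial_degree m = d}"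

definition squares_ideal :: "f2_poly set" where
  "squares_ideal = Idl\<^bsub>poly_F2\<^esub> {poly_var i ^ 2 | i. True}"

definition exterior :: "f2_poly set ring" where
  "exterior = poly_F2 Quot squares_ideal"

definition exterior_grading :: "int \<Rightarrow> f2_poly set set" where
  "exterior_grading = quotient_grading poly_F2 squares_ideal poly_grading"

end

theory Submission
  imports Defs
begin

text \<open>
  Square-free monomials of \<open>E\<close> correspond to finite sets of natural numbers, and the one that
  belongs to \<open>A\<close> has degree \<open>\<Sum>i\<in>A. 2 ^ i\<close>. Binary expansions are unique, so \<open>E\<close> has exactly one
  monomial in each degree \<open>n \<ge> 0\<close>, and homogeneous elements multiply like finite sets: \<open>e A \<otimes> e B\<close>
  is \<open>e (A \<union> B)\<close> if \<open>A\<close> and \<open>B\<close> are disjoint, and zero otherwise. Each of the three claims becomes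
  combinatorics of finite sets. That \<open>E\<close> has this form is
  \<open>exterior_binary_exterior_algebra\<close>; it amounts to the fact that a polynomial lies in the ideal of
  the squares if and only if none of its monomials is square-free (\<open>mem_squares_ideal_iff\<close>).

  Self-injectivity. By Baer's argument with Zorn's lemma (\<open>graded_baer_criterion\<close>) it suffices to
  extend homomorphisms of arbitrary degree \<open>d\<close> from homogeneous ideals of \<open>E\<close> to \<open>E\<close>, that is, to
  show that they are multiplications. If such a homomorphism sends \<open>e B\<close> to \<open>e C\<close>, then all \<open>e {i}\<close> with
  \<open>i \<in> B\<close> kill \<open>e C\<close>, hence \<open>B \<subseteq> C\<close>. The difference \<open>D = C - B\<close> is determined by its code \<open>d\<close>, and the
  homomorphism is multiplication by \<open>e D\<close> (\<open>partial_hom_is_multiplication\<close>).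

  Coherence. A homogeneous ideal with finitely many generators is generated by finitely many monomials
  \<open>e (A i)\<close>. The relations between them follow from the finitely many evident ones
  (\<open>monomial_ideal_finitely_presented\<close>).

  Reduced quotient. Over the two-element field squaring is additive, and it kills all monomials of
  positive degree. So the square of \<open>x\<close> is its component in degree \<open>0\<close>
  (\<open>mult_self_eq_component\<close>), and the nilpotent elements form the kernel of the augmentation.
\<close>

section \<open>Direct sum decompositions\<close>

lemma (in abelian_monoid) finsum_in_closed_set:
  assumes "f \<in> D \<rightarrow> S" "S \<subseteq> carrier G" "\<zero> \<in> S"
    and "\<And>x y. x \<in> S \<Longrightarrow> y \<in> S \<Longrightarrow> x \<oplus> y \<in> S"
  shows "(\<Oplus>i\<in>D. f i) \<in> S"
  using assms(1)
proof (induction D rule: infinite_finite_induct)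
  case (insert i D)
  with assms have "finsum G f (insert i D) = f i \<oplus> finsum G f D"
    by (intro finsum_insert) auto
  with insert assms show ?case by auto
qed (use assms in auto)

locale graded_group = abelian_group A for A :: "('a, 'e) ring_scheme" (structure) +
  fixes G :: "int \<Rightarrow> 'a set"
  assumes grading: "direct_sum_grading A G"
begin

lemma homogeneous_subgroup: "additive_subgroup (G d) A"
  using grading by (simp add: direct_sum_grading_def)

lemma homogeneous_closed: "x \<in> G d \<Longrightarrow> x \<in> carrier A"
  using additive_subgroup.a_subset[OF homogeneous_subgroup] by blast

lemma zero_homogeneous: "\<zero> \<in> G d"
  by (simp add: additive_subgroup.zero_closed homogeneous_subgroup)

lemma add_homogeneous: "x \<in> G d \<Longrightarrow> y \<in> G d \<Longrightarrow> x \<oplus> y \<in> G d"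
  by (simp add: additive_subgroup.a_closed homogeneous_subgroup)

lemma minus_homogeneous: "x \<in> G d \<Longrightarrow> \<ominus> x \<in> G d"
  by (simp add: additive_subgroup.a_inv_closed[OF homogeneous_subgroup])

definition component :: "'a \<Rightarrow> int \<Rightarrow> 'a" where
  "component x = (THE c. (\<forall>d. c d \<in> G d) \<and> finite {d. c d \<noteq> \<zero>} \<and>
     x = (\<Oplus>d\<in>{d. c d \<noteq> \<zero>}. c d))"

lemma
  assumes "x \<in> carrier A"
  shows component_homogeneous: "component x d \<in> G d"
    and finite_components: "finite {d. component x d \<noteq> \<zero>}"
    and sum_components: "(\<Oplus>d\<in>{d. component x d \<noteq> \<zero>}. component x d) = x"
proof -
  have "\<exists>!c. (\<forall>d. c d \<in> G d) \<and> finite {d. c d \<noteq> \<zero>} \<and> x = (\<Oplus>d\<in>{d. c d \<noteq> \<zero>}. c d)"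
    using grading assms by (simp add: direct_sum_grading_def)
  from theI'[OF this] show "component x d \<in> G d" "finite {d. component x d \<noteq> \<zero>}"
    "(\<Oplus>d\<in>{d. component x d \<noteq> \<zero>}. component x d) = x"
    unfolding component_def by auto
qed

lemma component_closed: "x \<in> carrier A \<Longrightarrow> component x d \<in> carrier A"
  using component_homogeneous homogeneous_closed by blast

lemma finsum_support:
  assumes "finite D" "\<And>d. d \<notin> D \<Longrightarrow> c d = \<zero>" "\<And>d. c d \<in> carrier A"
  shows "(\<Oplus>d\<in>{d. c d \<noteq> \<zero>}. c d) = (\<Oplus>d\<in>D. c d)"
  using assms by (intro add.finprod_mono_neutral_cong_left) auto

lemma component_unique:
  assumes c: "\<And>d. c d \<in> G d" and D: "finite D" "\<And>d. d \<notin> D \<Longrightarrow> c d = \<zero>"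
    and x: "x = (\<Oplus>d\<in>D. c d)"
  shows "component x = c"
proof -
  have cl: "c d \<in> carrier A" for d using c homogeneous_closed by blast
  then have "x \<in> carrier A" unfolding x by (intro finsum_closed) auto
  then have "\<exists>!c. (\<forall>d. c d \<in> G d) \<and> finite {d. c d \<noteq> \<zero>} \<and> x = (\<Oplus>d\<in>{d. c d \<noteq> \<zero>}. c d)"
    using grading by (simp add: direct_sum_grading_def)
  moreover have "finite {d. c d \<noteq> \<zero>}"
    using D by (rule_tac finite_subset[of _ D]) auto
  ultimately show ?thesis
    unfolding component_def using finsum_support[of D c, OF D cl] c x
    by (intro the1_equality) auto
qed

lemma sum_components_superset:
  assumes "x \<in> carrier A" "finite D" "\<And>d. d \<notin> D \<Longrightarrow> component x d = \<zero>"
  shows "(\<Oplus>d\<in>D. component x d) = x"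
  using finsum_support[of D "component x"] assms sum_components component_closed by auto

lemma component_of_homogeneous:
  assumes "x \<in> G d"
  shows "component x = (\<lambda>e. if e = d then x else \<zero>)"
proof (rule component_unique[of _ "{d}"])
  have "finsum A (\<lambda>e. if e = d then x else \<zero>) {d} = x"
    using assms homogeneous_closed by (subst finsum_insert) auto
  then show "x = (\<Oplus>e\<in>{d}. if e = d then x else \<zero>)" by simp
qed (use assms zero_homogeneous in auto)

lemma component_zero: "component \<zero> = (\<lambda>_. \<zero>)"
  using component_of_homogeneous[OF zero_homogeneous[of 0]] by auto

lemma component_add:
  assumes x: "x \<in> carrier A" and y: "y \<in> carrier A"
  shows "component (x \<oplus> y) = (\<lambda>d. component x d \<oplus> component y d)"
proof -
  let ?D = "{d. component x d \<noteq> \<zero>} \<union> {d. component y d \<noteq> \<zero>}"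
  have D: "finite ?D" using x y finite_components by blast
  have "x \<oplus> y = (\<Oplus>d\<in>?D. component x d) \<oplus> (\<Oplus>d\<in>?D. component y d)"
    using sum_components_superset[OF x D] sum_components_superset[OF y D] by auto
  also have "\<dots> = (\<Oplus>d\<in>?D. component x d \<oplus> component y d)"
    using x y component_closed by (intro finsum_addf[symmetric]) auto
  finally show ?thesis
    using D x y component_homogeneous add_homogeneous by (intro component_unique[of _ ?D]) auto
qed

lemma homogeneous_induct [consumes 1, case_names homogeneous add]:
  assumes x: "x \<in> carrier A"
    and hom: "\<And>d x. x \<in> G d \<Longrightarrow> P x"
    and add: "\<And>x y. x \<in> carrier A \<Longrightarrow> y \<in> carrier A \<Longrightarrow> P x \<Longrightarrow> P y \<Longrightarrow> P (x \<oplus> y)"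
  shows "P x"
proof -
  have "(\<Oplus>d\<in>{d. component x d \<noteq> \<zero>}. component x d) \<in> {x \<in> carrier A. P x}"
    using x component_homogeneous[OF x] component_closed zero_homogeneous
    by (intro finsum_in_closed_set) (auto intro: hom add)
  then show ?thesis using sum_components[OF x] by simp
qed

text \<open>
  This is the universal property of the direct sum: \<open>h\<close> adds up the values of \<open>g\<close> on the
  components.
\<close>

lemma extend_additively:
  assumes B: "abelian_group B"
    and g: "\<And>d x. x \<in> G d \<Longrightarrow> g d x \<in> carrier B"
    and g_add: "\<And>d x y. x \<in> G d \<Longrightarrow> y \<in> G d \<Longrightarrow> g d (x \<oplus> y) = g d x \<oplus>\<^bsub>B\<^esub> g d y"
  obtains h where "h \<in> carrier A \<rightarrow> carrier B"
    and "\<And>x y. x \<in> carrier A \<Longrightarrow> y \<in> carrier A \<Longrightarrow> h (x \<oplus> y) = h x \<oplus>\<^bsub>B\<^esub> h y"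
    and "\<And>d x. x \<in> G d \<Longrightarrow> h x = g d x"
proof
  interpret B: abelian_group B by fact
  let ?supp = "\<lambda>x. {d. component x d \<noteq> \<zero>}"
  let ?h = "\<lambda>x. \<Oplus>\<^bsub>B\<^esub>d\<in>?supp x. g d (component x d)"
  have g0: "g d \<zero> = \<zero>\<^bsub>B\<^esub>" for d
  proof -
    have "g d \<zero> \<oplus>\<^bsub>B\<^esub> g d \<zero> = g d \<zero>"
      using g_add[of \<zero> d \<zero>] zero_homogeneous by simp
    then show ?thesis
      using B.add.r_cancel_one[of "g d \<zero>" "g d \<zero>"] g zero_homogeneous by simp
  qed
  have gcl: "g d (component x d) \<in> carrier B" if "x \<in> carrier A" for d x
    using that g component_homogeneous by simp
  have h_superset: "?h x = (\<Oplus>\<^bsub>B\<^esub>d\<in>D. g d (component x d))"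
    if "x \<in> carrier A" "finite D" "?supp x \<subseteq> D" for x D
    using that gcl g0 by (intro B.add.finprod_mono_neutral_cong_left) auto
  show "?h \<in> carrier A \<rightarrow> carrier B"
    using gcl by (auto intro!: B.finsum_closed)
  show "?h (x \<oplus> y) = ?h x \<oplus>\<^bsub>B\<^esub> ?h y" if x: "x \<in> carrier A" and y: "y \<in> carrier A" for x y
  proof -
    let ?D = "?supp x \<union> ?supp y"
    have D: "finite ?D" using x y finite_components by blast
    have "?h (x \<oplus> y) = (\<Oplus>\<^bsub>B\<^esub>d\<in>?D. g d (component (x \<oplus> y) d))"
      using x y D by (intro h_superset) (auto simp: component_add)
    also have "\<dots> = (\<Oplus>\<^bsub>B\<^esub>d\<in>?D. g d (component x d) \<oplus>\<^bsub>B\<^esub> g d (component y d))"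
      using x y by (intro B.finsum_cong') (auto simp: component_add g_add component_homogeneous gcl)
    also have "\<dots> = ?h x \<oplus>\<^bsub>B\<^esub> ?h y"
      using x y D gcl by (subst B.finsum_addf) (auto simp: h_superset[of x ?D] h_superset[of y ?D])
    finally show ?thesis .
  qed
  show "?h x = g d x" if "x \<in> G d" for x d
  proof -
    have "?h x = (\<Oplus>\<^bsub>B\<^esub>e\<in>{d}. g e (component x e))"
      using that homogeneous_closed by (intro h_superset) (auto simp: component_of_homogeneous)
    also have "\<dots> = g d x"
      using that g by (subst B.finsum_insert) (auto simp: component_of_homogeneous)
    finally show ?thesis .
  qed
qed

end

text \<open>
  The projections \<open>\<pi> d\<close> recover the components of a sum, so the decomposition is unique. An induction
  principle replaces its existence: the elements that are the sum of their projections include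
  the homogeneous ones and are closed under addition.
\<close>

lemma direct_sum_gradingI:
  fixes A :: "('a, 'e) ring_scheme" (structure)
  assumes A: "abelian_group A" and sub: "\<And>d. additive_subgroup (G d) A"
    and \<pi>_hom: "\<And>x d. x \<in> carrier A \<Longrightarrow> \<pi> d x \<in> G d"
    and \<pi>_add: "\<And>x y d. x \<in> carrier A \<Longrightarrow> y \<in> carrier A \<Longrightarrow> \<pi> d (x \<oplus> y) = \<pi> d x \<oplus> \<pi> d y"
    and \<pi>_on: "\<And>x d e. x \<in> G e \<Longrightarrow> \<pi> d x = (if d = e then x else \<zero>)"
    and induct: "\<And>P x. x \<in> carrier A \<Longrightarrow> (\<And>d x. x \<in> G d \<Longrightarrow> P x) \<Longrightarrow>
      (\<And>x y. x \<in> carrier A \<Longrightarrow> y \<in> carrier A \<Longrightarrow> P x \<Longrightarrow> P y \<Longrightarrow> P (x \<oplus> y)) \<Longrightarrow> P x"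
  shows "direct_sum_grading A G"
  unfolding direct_sum_grading_def
proof (intro conjI allI ballI)
  interpret abelian_group A by fact
  have cl: "x \<in> carrier A" if "x \<in> G d" for x d
    using that additive_subgroup.a_subset[OF sub] by blast
  have z: "\<zero> \<in> G d" for d by (simp add: additive_subgroup.zero_closed sub)
  have \<pi>_cl: "\<pi> d x \<in> carrier A" if "x \<in> carrier A" for x d using \<pi>_hom cl that by blast
  have extend: "(\<Oplus>d\<in>{d. c d \<noteq> \<zero>}. c d) = (\<Oplus>d\<in>D. c d)"
    if "finite D" "{d. c d \<noteq> \<zero>} \<subseteq> D" "\<And>d. c d \<in> carrier A" for c and D :: "int set"
    using that by (intro add.finprod_mono_neutral_cong_left) auto
  let ?S = "\<lambda>x. {d. \<pi> d x \<noteq> \<zero>}"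
  show "additive_subgroup (G d) A" for d by (rule sub)
  fix x assume x: "x \<in> carrier A"
  have ex: "finite (?S x) \<and> (\<Oplus>d\<in>?S x. \<pi> d x) = x"
    using x
  proof (rule induct)
    fix d x assume xd: "x \<in> G d"
    then have S: "?S x \<subseteq> {d}" by (auto simp: \<pi>_on)
    moreover have "(\<Oplus>d\<in>?S x. \<pi> d x) = (\<Oplus>d\<in>{d}. \<pi> d x)"
      using S xd cl \<pi>_cl by (intro extend) auto
    moreover have "(\<Oplus>d\<in>{d}. \<pi> d x) = x"
      using xd cl by (subst finsum_insert) (auto simp: \<pi>_on)
    ultimately show "finite (?S x) \<and> (\<Oplus>d\<in>?S x. \<pi> d x) = x"
      using finite_subset by auto
  next
    fix x y assume x: "x \<in> carrier A" and y: "y \<in> carrier A"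
      and px: "finite (?S x) \<and> (\<Oplus>d\<in>?S x. \<pi> d x) = x"
      and py: "finite (?S y) \<and> (\<Oplus>d\<in>?S y. \<pi> d y) = y"
    let ?D = "?S x \<union> ?S y"
    have D: "finite ?D" "?S (x \<oplus> y) \<subseteq> ?D" using x y px py by (auto simp: \<pi>_add)
    have "(\<Oplus>d\<in>?S (x \<oplus> y). \<pi> d (x \<oplus> y)) = (\<Oplus>d\<in>?D. \<pi> d x \<oplus> \<pi> d y)"
      using x y \<pi>_cl D extend[of ?D "\<lambda>d. \<pi> d (x \<oplus> y)"] by (simp add: \<pi>_add)
    also have "\<dots> = (\<Oplus>d\<in>?D. \<pi> d x) \<oplus> (\<Oplus>d\<in>?D. \<pi> d y)"
      using x y \<pi>_cl by (intro finsum_addf) auto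
    also have "\<dots> = x \<oplus> y"
      using x y \<pi>_cl D px py extend[of ?D "\<lambda>d. \<pi> d x"] extend[of ?D "\<lambda>d. \<pi> d y"] by auto
    finally show "finite (?S (x \<oplus> y)) \<and> (\<Oplus>d\<in>?S (x \<oplus> y). \<pi> d (x \<oplus> y)) = x \<oplus> y"
      using D finite_subset by blast
  qed
  show "\<exists>!c. (\<forall>d. c d \<in> G d) \<and> finite {d. c d \<noteq> \<zero>} \<and> x = (\<Oplus>d\<in>{d. c d \<noteq> \<zero>}. c d)"
  proof (intro ex1I[of _ "\<lambda>d. \<pi> d x"] ext)
    show "(\<forall>d. \<pi> d x \<in> G d) \<and> finite (?S x) \<and> x = (\<Oplus>d\<in>?S x. \<pi> d x)"
      using ex x \<pi>_hom by simp
  next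
    fix c d
    assume "(\<forall>d. c d \<in> G d) \<and> finite {d. c d \<noteq> \<zero>} \<and> x = (\<Oplus>d\<in>{d. c d \<noteq> \<zero>}. c d)"
    then have c: "\<And>d. c d \<in> G d" and fin: "finite {d. c d \<noteq> \<zero>}"
      and sum: "x = (\<Oplus>d\<in>{d. c d \<noteq> \<zero>}. c d)" by auto
    have "\<pi> d (\<Oplus>e\<in>D. c e) = (if d \<in> D then c d else \<zero>)" if "finite D" for D
      using that
    proof (induction D rule: finite_induct)
      case empty
      then show ?case using \<pi>_on[OF z] by simp
    next
      case (insert e D)
      have "finsum A c D \<in> carrier A" using c cl by (intro finsum_closed) auto
      moreover have "finsum A c (insert e D) = c e \<oplus> finsum A c D"
        using insert c cl by (intro finsum_insert) auto
      ultimately show ?case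
        using insert c[THEN cl] \<pi>_on[OF c[of e]] by (auto simp: \<pi>_add)
    qed
    from this[OF fin] show "c d = \<pi> d x" using sum by auto
  qed
qed

section \<open>Ideals and free modules as graded modules\<close>

lemma (in abelian_group) additive_subgroup_of_closed:
  assumes "S \<subseteq> carrier G" "\<zero> \<in> S"
    and "\<And>x y. x \<in> S \<Longrightarrow> y \<in> S \<Longrightarrow> x \<oplus> y \<in> S"
    and inv: "\<And>x. x \<in> S \<Longrightarrow> \<exists>y\<in>S. y \<oplus> x = \<zero>"
  shows "additive_subgroup S G"
proof (intro additive_subgroupI add.subgroupI)
  show "\<ominus> x \<in> S" if x: "x \<in> S" for x
  proof -
    obtain y where "y \<in> S" "y \<oplus> x = \<zero>" using inv[OF x] by blast
    moreover from this have "\<ominus> x = y" using assms(1) x by (intro minus_equality) auto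
    ultimately show ?thesis by (simp add: a_inv_def)
  qed
qed (use assms in auto)

sublocale graded_ring \<subseteq> graded_group R G
  by unfold_locales (rule ring_grading)

sublocale graded_module \<subseteq> M: graded_group M H
  by unfold_locales (rule module_grading)

lemma ideal_module_simps [simp]:
  "carrier (ideal_module R I) = I"
  "\<zero>\<^bsub>ideal_module R I\<^esub> = \<zero>\<^bsub>R\<^esub>"
  "x \<oplus>\<^bsub>ideal_module R I\<^esub> y = x \<oplus>\<^bsub>R\<^esub> y"
  "a \<odot>\<^bsub>ideal_module R I\<^esub> x = a \<otimes>\<^bsub>R\<^esub> x"
  by (simp_all add: ideal_module_def)

context graded_ring
begin

lemma graded_module_ideal:
  assumes I: "ideal I R" and comp: "\<And>x d. x \<in> I \<Longrightarrow> component x d \<in> I"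
  shows "graded_module R G (ideal_module R I) (\<lambda>d. I \<inter> G d)"
proof -
  interpret I: ideal I R by fact
  have neg: "\<exists>y\<in>S. y \<oplus> x = \<zero>" if "x \<in> S" "S \<subseteq> carrier R" "\<And>x. x \<in> S \<Longrightarrow> \<ominus> x \<in> S" for x S
    using that l_neg by blast
  interpret M: abelian_group "ideal_module R I"
    using I.Icarr by (intro abelian_groupI) (auto simp: a_assoc intro!: neg a_comm)
  have "direct_sum_grading (ideal_module R I) (\<lambda>d. I \<inter> G d)"
  proof (rule direct_sum_gradingI[where \<pi> = "\<lambda>d x. component x d"])
    show "abelian_group (ideal_module R I)" by unfold_locales
    show "additive_subgroup (I \<inter> G d) (ideal_module R I)" for d
      by (intro M.additive_subgroup_of_closed)
        (use homogeneous_closed in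
          \<open>auto simp: zero_homogeneous add_homogeneous minus_homogeneous intro!: neg\<close>)
  next
    fix P x
    assume x: "x \<in> carrier (ideal_module R I)"
      and hom: "\<And>d x. x \<in> I \<inter> G d \<Longrightarrow> P x"
      and add: "\<And>x y. x \<in> carrier (ideal_module R I) \<Longrightarrow> y \<in> carrier (ideal_module R I) \<Longrightarrow>
        P x \<Longrightarrow> P y \<Longrightarrow> P (x \<oplus>\<^bsub>ideal_module R I\<^esub> y)"
    have xR: "x \<in> carrier R" using x I.Icarr by simp
    have "P (component x d)" for d
      using x xR comp component_homogeneous by (intro hom[of _ d]) auto
    then have "(\<Oplus>d\<in>{d. component x d \<noteq> \<zero>}. component x d) \<in> {x \<in> I. P x}"
      using x I.Icarr comp add hom[of \<zero> 0] zero_homogeneous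
      by (intro finsum_in_closed_set) auto
    then show "P x" using sum_components[OF xR] by simp
  qed (use I.Icarr comp component_homogeneous component_of_homogeneous in \<open>auto simp: component_add\<close>)
  then show ?thesis
    using I.Icarr homogeneous_closed
    by unfold_locales (auto simp: l_distr r_distr m_assoc I.I_l_closed mult_homogeneous)
qed

lemma graded_module_self: "graded_module R G (ideal_module R (carrier R)) G"
proof -
  have "(\<lambda>d. carrier R \<inter> G d) = G" using homogeneous_closed by blast
  then show ?thesis
    using graded_module_ideal[OF oneideal] component_closed by simp
qed

text \<open>
  The elements all of whose components lie in the ideal form an ideal themselves, and the
  generators are among them.
\<close>

lemma component_in_genideal:
  assumes S: "S \<subseteq> (\<Union>d. G d)" and x: "x \<in> Idl S"
  shows "component x d \<in> Idl S"
proof -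
  have "S \<subseteq> carrier R" using S homogeneous_closed by blast
  then have SI: "S \<subseteq> Idl S" and I: "ideal (Idl S) R"
    using genideal_self genideal_ideal by auto
  interpret I: ideal "Idl S" R by fact
  let ?P = "{x \<in> carrier R. \<forall>d. component x d \<in> Idl S}"
  have hom: "x \<in> ?P" if "x \<in> Idl S" "x \<in> G d" for x d
    using that I.Icarr by (auto simp: component_of_homogeneous)
  have addP: "x \<oplus> y \<in> ?P" if "x \<in> ?P" "y \<in> ?P" for x y
    using that by (auto simp: component_add)
  have zero: "\<zero> \<in> ?P" using hom[of \<zero> 0] zero_homogeneous by simp
  have sum: "finsum R f D \<in> ?P" if "\<And>i. i \<in> D \<Longrightarrow> f i \<in> ?P" for f and D :: "int set"
    using that addP zero by (intro finsum_in_closed_set) auto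
  have mult: "a \<otimes> x \<in> ?P \<and> x \<otimes> a \<in> ?P" if "a \<in> carrier R" "x \<in> ?P" for a x
    using that(1)
  proof (induction rule: homogeneous_induct)
    case (homogeneous d a)
    have a: "a \<in> carrier R" using homogeneous homogeneous_closed by blast
    have fin: "finite {e. component x e \<noteq> \<zero>}" and x: "x \<in> carrier R"
      using that finite_components by auto
    have cl: "component x \<in> {e. component x e \<noteq> \<zero>} \<rightarrow> carrier R"
      using x component_closed by blast
    have "a \<otimes> x = (\<Oplus>e\<in>{e. component x e \<noteq> \<zero>}. a \<otimes> component x e)"
      using finsum_rdistr[OF fin a cl] sum_components[OF x] by simp
    moreover have "x \<otimes> a = (\<Oplus>e\<in>{e. component x e \<noteq> \<zero>}. component x e \<otimes> a)"
      using finsum_ldistr[OF fin a cl] sum_components[OF x] by simp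
    moreover have "a \<otimes> component x e \<in> ?P" for e
      using that a x homogeneous component_homogeneous[of x e]
      by (intro hom[of _ "d + e"] I.I_l_closed mult_homogeneous) auto
    moreover have "component x e \<otimes> a \<in> ?P" for e
      using that a x homogeneous component_homogeneous[of x e]
      by (intro hom[of _ "e + d"] I.I_r_closed mult_homogeneous) auto
    ultimately show ?case using sum by auto
  next
    case (add a b)
    then show ?case
      using that addP[of "a \<otimes> x" "b \<otimes> x"] addP[of "x \<otimes> a" "x \<otimes> b"]
      by (simp add: l_distr r_distr)
  qed
  have "\<ominus> x \<in> ?P" if "x \<in> ?P" for x
    using mult[of "\<ominus> \<one>" x] that by (simp add: l_minus)
  then have neg: "\<exists>y\<in>?P. y \<oplus> x = \<zero>" if "x \<in> ?P" for x
    using that l_neg[of x] by blast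
  have "additive_subgroup ?P R"
    using neg zero addP by (intro additive_subgroup_of_closed) auto
  then have "ideal ?P R"
    using mult by (intro idealI ring_axioms) (auto dest: additive_subgroup.a_subgroup)
  moreover have "S \<subseteq> ?P" using S SI hom by blast
  ultimately show ?thesis using x genideal_minimal by blast
qed

end

lemma free_module_simps [simp]:
  "carrier (free_module R ds) = {..<length ds} \<rightarrow>\<^sub>E carrier R"
  "\<zero>\<^bsub>free_module R ds\<^esub> = (\<lambda>i\<in>{..<length ds}. \<zero>\<^bsub>R\<^esub>)"
  "v \<oplus>\<^bsub>free_module R ds\<^esub> w = (\<lambda>i\<in>{..<length ds}. v i \<oplus>\<^bsub>R\<^esub> w i)"
  "a \<odot>\<^bsub>free_module R ds\<^esub> v = (\<lambda>i\<in>{..<length ds}. a \<otimes>\<^bsub>R\<^esub> v i)"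
  by (simp_all add: free_module_def)

definition coordinate_vector :: "('a, 'r) ring_scheme \<Rightarrow> int list \<Rightarrow> nat \<Rightarrow> 'a \<Rightarrow> nat \<Rightarrow> 'a" where
  "coordinate_vector R ds i a = (\<lambda>j\<in>{..<length ds}. if j = i then a else \<zero>\<^bsub>R\<^esub>)"

context graded_ring
begin

lemma coordinate_vector_closed:
  "a \<in> carrier R \<Longrightarrow> coordinate_vector R ds i a \<in> carrier (free_module R ds)"
  by (auto simp: coordinate_vector_def)

lemma coordinate_vector_homogeneous:
  "a \<in> G d \<Longrightarrow> i < length ds \<Longrightarrow> coordinate_vector R ds i a \<in> free_grading G ds (d + ds ! i)"
  by (auto simp: coordinate_vector_def free_grading_def zero_homogeneous)

lemma coordinate_vector_add:
  "a \<in> carrier R \<Longrightarrow> b \<in> carrier R \<Longrightarrow> coordinate_vector R ds i (a \<oplus> b) =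
    coordinate_vector R ds i a \<oplus>\<^bsub>free_module R ds\<^esub> coordinate_vector R ds i b"
  by (auto simp: coordinate_vector_def fun_eq_iff)

lemma smult_coordinate_vector:
  "a \<in> carrier R \<Longrightarrow> b \<in> carrier R \<Longrightarrow>
    a \<odot>\<^bsub>free_module R ds\<^esub> coordinate_vector R ds i b = coordinate_vector R ds i (a \<otimes> b)"
  by (auto simp: coordinate_vector_def fun_eq_iff)

lemma free_module_induct [consumes 1, case_names zero coordinate add]:
  assumes v: "v \<in> carrier (free_module R ds)"
    and zero: "P \<zero>\<^bsub>free_module R ds\<^esub>"
    and coord: "\<And>i d a. i < length ds \<Longrightarrow> a \<in> G d \<Longrightarrow> P (coordinate_vector R ds i a)"
    and add: "\<And>v w. v \<in> carrier (free_module R ds) \<Longrightarrow> w \<in> carrier (free_module R ds) \<Longrightarrow>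
      P v \<Longrightarrow> P w \<Longrightarrow> P (v \<oplus>\<^bsub>free_module R ds\<^esub> w)"
  shows "P v"
proof -
  have coord': "P (coordinate_vector R ds i a)" if "a \<in> carrier R" "i < length ds" for i a
    using that
    by (induction rule: homogeneous_induct)
      (auto simp del: free_module_simps simp: coordinate_vector_add coord
        intro!: add coordinate_vector_closed)
  \<comment> \<open>Fill in the coordinates one at a time.\<close>
  let ?trunc = "\<lambda>n. \<lambda>j\<in>{..<length ds}. if j < n then v j else \<zero>"
  have "P (?trunc n)" if "n \<le> length ds" for n
    using that
  proof (induction n)
    case 0
    then show ?case using zero by (simp add: restrict_def)
  next
    case (Suc n)
    then have vn: "v n \<in> carrier R" using v by (auto simp: PiE_iff)
    have "?trunc (Suc n) = ?trunc n \<oplus>\<^bsub>free_module R ds\<^esub> coordinate_vector R ds n (v n)"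
      using v by (auto simp: coordinate_vector_def fun_eq_iff PiE_iff less_Suc_eq)
    moreover have "?trunc n \<in> carrier (free_module R ds)" using v by (auto simp: PiE_iff)
    moreover have "P (?trunc n)" using Suc by (simp only: Suc_leD)
    moreover have "P (coordinate_vector R ds n (v n))" using Suc vn coord' by simp
    ultimately show ?case
      using add[OF _ coordinate_vector_closed[OF vn]] by presburger
  qed
  moreover have "?trunc (length ds) = v"
    using v by (auto simp: fun_eq_iff PiE_iff extensional_def)
  ultimately show ?thesis by (metis order_refl)
qed

lemma graded_module_free: "graded_module R G (free_module R ds) (free_grading G ds)"
proof -
  let ?F = "free_module R ds"
  interpret F: abelian_group ?F
  proof (rule abelian_groupI)
    show "\<exists>y\<in>carrier ?F. y \<oplus>\<^bsub>?F\<^esub> x = \<zero>\<^bsub>?F\<^esub>" if "x \<in> carrier ?F" for x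
      using that
      by (intro bexI[of _ "\<lambda>i\<in>{..<length ds}. \<ominus> x i"]) (auto simp: PiE_iff l_neg fun_eq_iff)
  qed (auto simp: PiE_iff fun_eq_iff extensional_def a_ac)
  have hom_cl: "free_grading G ds d \<subseteq> carrier ?F" for d
    using homogeneous_closed by (auto simp: free_grading_def PiE_iff)
  have "direct_sum_grading ?F (free_grading G ds)"
  proof (rule direct_sum_gradingI[where
        \<pi> = "\<lambda>d v. \<lambda>i\<in>{..<length ds}. component (v i) (d - ds ! i)"])
    show "abelian_group ?F" by unfold_locales
    show "additive_subgroup (free_grading G ds d) ?F" for d
    proof (rule F.additive_subgroup_of_closed[OF hom_cl])
      show "\<exists>y\<in>free_grading G ds d. y \<oplus>\<^bsub>?F\<^esub> x = \<zero>\<^bsub>?F\<^esub>" if "x \<in> free_grading G ds d" for x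
        using that homogeneous_closed[of "x i" "d - ds ! i" for i]
        by (intro bexI[of _ "\<lambda>i\<in>{..<length ds}. \<ominus> x i"])
          (auto simp: free_grading_def PiE_iff l_neg fun_eq_iff minus_homogeneous)
    qed (auto simp: free_grading_def PiE_iff zero_homogeneous add_homogeneous)
    show "(\<lambda>i\<in>{..<length ds}. component (x i) (d - ds ! i)) =
        (if d = e then x else \<zero>\<^bsub>?F\<^esub>)" if "x \<in> free_grading G ds e" for x d e
    proof
      fix i
      show "(\<lambda>i\<in>{..<length ds}. component (x i) (d - ds ! i)) i =
        (if d = e then x else \<zero>\<^bsub>?F\<^esub>) i"
        using that component_of_homogeneous[of "x i" "e - ds ! i"]
        by (auto simp: free_grading_def PiE_iff extensional_def)
    qed
    fix P v
    assume v: "v \<in> carrier ?F" and hom: "\<And>d v. v \<in> free_grading G ds d \<Longrightarrow> P v"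
      and add: "\<And>v w. v \<in> carrier ?F \<Longrightarrow> w \<in> carrier ?F \<Longrightarrow> P v \<Longrightarrow> P w \<Longrightarrow> P (v \<oplus>\<^bsub>?F\<^esub> w)"
    show "P v"
      using v
    proof (induction rule: free_module_induct)
      case zero
      show ?case by (rule hom[of _ 0]) (auto simp: free_grading_def zero_homogeneous split: if_splits)
    next
      case (coordinate i d a)
      then show ?case using hom coordinate_vector_homogeneous by blast
    qed (rule add)
  qed (auto simp: free_grading_def PiE_iff component_add component_homogeneous)
  then show ?thesis
    using homogeneous_closed
    by unfold_locales
      (auto simp: PiE_iff fun_eq_iff extensional_def l_distr r_distr m_assoc free_grading_def
        add_diff_eq[symmetric] mult_homogeneous)
qed

end

definition linear_combination :: "('a, 'm) module \<Rightarrow> 'm list \<Rightarrow> (nat \<Rightarrow> 'a) \<Rightarrow> 'm" where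
  "linear_combination M ts w = (\<Oplus>\<^bsub>M\<^esub>i\<in>{..<length ts}. w i \<odot>\<^bsub>M\<^esub> ts ! i)"

context graded_module
begin

lemma zero_smult: "x \<in> carrier M \<Longrightarrow> \<zero>\<^bsub>R\<^esub> \<odot>\<^bsub>M\<^esub> x = \<zero>\<^bsub>M\<^esub>"
  using smult_l_distr[of "\<zero>\<^bsub>R\<^esub>" "\<zero>\<^bsub>R\<^esub>" x] smult_closed[of "\<zero>\<^bsub>R\<^esub>" x]
    M.add.r_cancel_one[of "\<zero>\<^bsub>R\<^esub> \<odot>\<^bsub>M\<^esub> x" "\<zero>\<^bsub>R\<^esub> \<odot>\<^bsub>M\<^esub> x"] by simp

lemma smult_zero: "a \<in> carrier R \<Longrightarrow> a \<odot>\<^bsub>M\<^esub> \<zero>\<^bsub>M\<^esub> = \<zero>\<^bsub>M\<^esub>"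
  using smult_r_distr[of a "\<zero>\<^bsub>M\<^esub>" "\<zero>\<^bsub>M\<^esub>"] smult_closed[of a "\<zero>\<^bsub>M\<^esub>"]
    M.add.r_cancel_one[of "a \<odot>\<^bsub>M\<^esub> \<zero>\<^bsub>M\<^esub>" "a \<odot>\<^bsub>M\<^esub> \<zero>\<^bsub>M\<^esub>"] by simp

lemma minus_one_smult:
  assumes "x \<in> carrier M"
  shows "(\<ominus>\<^bsub>R\<^esub> \<one>\<^bsub>R\<^esub>) \<odot>\<^bsub>M\<^esub> x = \<ominus>\<^bsub>M\<^esub> x"
proof -
  have "(\<ominus>\<^bsub>R\<^esub> \<one>\<^bsub>R\<^esub>) \<odot>\<^bsub>M\<^esub> x \<oplus>\<^bsub>M\<^esub> x = (\<ominus>\<^bsub>R\<^esub> \<one>\<^bsub>R\<^esub> \<oplus>\<^bsub>R\<^esub> \<one>\<^bsub>R\<^esub>) \<odot>\<^bsub>M\<^esub> x"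
    using assms by (simp add: smult_l_distr smult_one)
  also have "\<dots> = \<zero>\<^bsub>M\<^esub>"
    using assms zero_smult by (simp add: abelian_group.l_neg[OF ring.axioms(1)[OF ring_axioms]])
  finally show ?thesis
    using assms smult_closed by (intro M.minus_equality[symmetric]) auto
qed

lemma smult_finsum:
  assumes "a \<in> carrier R" "finite D" "f \<in> D \<rightarrow> carrier M"
  shows "a \<odot>\<^bsub>M\<^esub> (\<Oplus>\<^bsub>M\<^esub>i\<in>D. f i) = (\<Oplus>\<^bsub>M\<^esub>i\<in>D. a \<odot>\<^bsub>M\<^esub> f i)"
  using assms(2,3)
proof (induction D rule: finite_induct)
  case empty
  then show ?case using assms(1) smult_zero by simp
next
  case (insert i D)
  then show ?case
    using assms(1) smult_closed
    by (subst (1 2) M.finsum_insert) (auto simp: smult_r_distr)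
qed

lemma
  assumes len: "length ts = length es" and ts: "\<And>i. i < length es \<Longrightarrow> ts ! i \<in> H (es ! i)"
  shows linear_combination_hom: "linear_combination M ts \<in>
      graded_hom R (free_module R es) (free_grading G es) M H"
    and linear_combination_coordinate_vector: "\<And>i a. i < length es \<Longrightarrow> a \<in> carrier R \<Longrightarrow>
      linear_combination M ts (coordinate_vector R es i a) = a \<odot>\<^bsub>M\<^esub> ts ! i"
proof -
  have tcl: "ts ! i \<in> carrier M" if "i < length es" for i
    using ts that M.homogeneous_closed by blast
  show "linear_combination M ts \<in> graded_hom R (free_module R es) (free_grading G es) M H"
    unfolding graded_hom_def
  proof (intro CollectI conjI ballI allI)
    show "linear_combination M ts \<in> carrier (free_module R es) \<rightarrow> carrier M"
      using tcl len
      by (auto simp: linear_combination_def PiE_iff intro!: M.finsum_closed smult_closed)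
  next
    fix v w assume vw: "v \<in> carrier (free_module R es)" "w \<in> carrier (free_module R es)"
    have "linear_combination M ts (v \<oplus>\<^bsub>free_module R es\<^esub> w) =
      (\<Oplus>\<^bsub>M\<^esub>i\<in>{..<length ts}. v i \<odot>\<^bsub>M\<^esub> ts ! i \<oplus>\<^bsub>M\<^esub> w i \<odot>\<^bsub>M\<^esub> ts ! i)"
      unfolding linear_combination_def using tcl len vw
      by (intro M.finsum_cong') (auto simp: PiE_iff smult_l_distr intro!: smult_closed)
    also have "\<dots> = linear_combination M ts v \<oplus>\<^bsub>M\<^esub> linear_combination M ts w"
      unfolding linear_combination_def using tcl len vw
      by (intro M.finsum_addf) (auto simp: PiE_iff intro!: smult_closed)
    finally show "linear_combination M ts (v \<oplus>\<^bsub>free_module R es\<^esub> w) =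
      linear_combination M ts v \<oplus>\<^bsub>M\<^esub> linear_combination M ts w" .
  next
    fix a v assume av: "a \<in> carrier R" "v \<in> carrier (free_module R es)"
    have "linear_combination M ts (a \<odot>\<^bsub>free_module R es\<^esub> v) =
      (\<Oplus>\<^bsub>M\<^esub>i\<in>{..<length ts}. a \<odot>\<^bsub>M\<^esub> (v i \<odot>\<^bsub>M\<^esub> ts ! i))"
      unfolding linear_combination_def using tcl len av
      by (intro M.finsum_cong') (auto simp: PiE_iff smult_assoc1 intro!: smult_closed)
    also have "\<dots> = a \<odot>\<^bsub>M\<^esub> linear_combination M ts v"
      unfolding linear_combination_def using tcl len av
      by (intro smult_finsum[symmetric]) (auto simp: PiE_iff intro!: smult_closed)
    finally show "linear_combination M ts (a \<odot>\<^bsub>free_module R es\<^esub> v) =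
      a \<odot>\<^bsub>M\<^esub> linear_combination M ts v" .
  next
    fix k
    have "linear_combination M ts v \<in> H k" if "v \<in> free_grading G es k" for v
      unfolding linear_combination_def
    proof (intro M.finsum_in_closed_set)
      show "(\<lambda>i. v i \<odot>\<^bsub>M\<^esub> ts ! i) \<in> {..<length ts} \<rightarrow> H k"
      proof
        fix i assume "i \<in> {..<length ts}"
        then have "v i \<in> G (k - es ! i)" "ts ! i \<in> H (es ! i)"
          using that len ts by (auto simp: free_grading_def PiE_iff)
        then show "v i \<odot>\<^bsub>M\<^esub> ts ! i \<in> H k" using smult_homogeneous by fastforce
      qed
    qed (use M.homogeneous_closed M.zero_homogeneous M.add_homogeneous in auto)
    then show "linear_combination M ts ` free_grading G es k \<subseteq> H k" by blast
  qed
  show "linear_combination M ts (coordinate_vector R es i a) = a \<odot>\<^bsub>M\<^esub> ts ! i"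
    if "i < length es" "a \<in> carrier R" for i a
  proof -
    have "linear_combination M ts (coordinate_vector R es i a) =
      (\<Oplus>\<^bsub>M\<^esub>j\<in>{..<length ts}. if i = j then a \<odot>\<^bsub>M\<^esub> ts ! j else \<zero>\<^bsub>M\<^esub>)"
      unfolding linear_combination_def using tcl len that
      by (intro M.finsum_cong') (auto simp: coordinate_vector_def zero_smult intro!: smult_closed)
    also have "\<dots> = a \<odot>\<^bsub>M\<^esub> ts ! i"
      using tcl len that by (intro M.finsum_singleton) (auto intro!: smult_closed)
    finally show ?thesis .
  qed
qed

end

lemma graded_homD:
  assumes "h \<in> graded_hom R M H N K"
  shows "x \<in> carrier M \<Longrightarrow> h x \<in> carrier N"
    and "x \<in> carrier M \<Longrightarrow> y \<in> carrier M \<Longrightarrow> h (x \<oplus>\<^bsub>M\<^esub> y) = h x \<oplus>\<^bsub>N\<^esub> h y"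
    and "a \<in> carrier R \<Longrightarrow> x \<in> carrier M \<Longrightarrow> h (a \<odot>\<^bsub>M\<^esub> x) = a \<odot>\<^bsub>N\<^esub> h x"
    and "x \<in> H d \<Longrightarrow> h x \<in> K d"
  using assms unfolding graded_hom_def by (blast, simp, simp, blast)

lemma graded_hom_zero:
  assumes M: "graded_module R G M H" and N: "graded_module R G N K"
    and h: "h \<in> graded_hom R M H N K"
  shows "h \<zero>\<^bsub>M\<^esub> = \<zero>\<^bsub>N\<^esub>"
proof -
  interpret M: graded_module R G M H by fact
  interpret N: graded_module R G N K by fact
  have "h (\<zero>\<^bsub>R\<^esub> \<odot>\<^bsub>M\<^esub> \<zero>\<^bsub>M\<^esub>) = \<zero>\<^bsub>R\<^esub> \<odot>\<^bsub>N\<^esub> h \<zero>\<^bsub>M\<^esub>"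
    by (intro graded_homD(3)[OF h]) auto
  then show ?thesis
    using graded_homD(1)[OF h, of "\<zero>\<^bsub>M\<^esub>"] by (simp add: M.zero_smult N.zero_smult)
qed

section \<open>The graded Baer criterion\<close>

text \<open>
  A degree-preserving homomorphism from a graded submodule of \<open>N\<close> to \<open>Q\<close>, given by its graph.
  Recording only pairs of homogeneous elements, tagged with their degree, makes the union of a
  chain and the adjunction of one homogeneous element immediate; components of inhomogeneous
  elements enter only when a total graph is turned back into a function.
\<close>

locale partial_hom =
  N: graded_module R G N K + Q: graded_module R G Q L
  for R :: "('a, 'r) ring_scheme" and G :: "int \<Rightarrow> 'a set"
    and N :: "('a, 'n) module" and K :: "int \<Rightarrow> 'n set"
    and Q :: "('a, 'q) module" and L :: "int \<Rightarrow> 'q set" +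
  fixes \<Gamma> :: "(int \<times> 'n \<times> 'q) set"
  assumes dom: "(d, x, y) \<in> \<Gamma> \<Longrightarrow> x \<in> K d"
    and ran: "(d, x, y) \<in> \<Gamma> \<Longrightarrow> y \<in> L d"
    and zero: "(d, \<zero>\<^bsub>N\<^esub>, \<zero>\<^bsub>Q\<^esub>) \<in> \<Gamma>"
    and add: "(d, x, y) \<in> \<Gamma> \<Longrightarrow> (d, u, v) \<in> \<Gamma> \<Longrightarrow> (d, x \<oplus>\<^bsub>N\<^esub> u, y \<oplus>\<^bsub>Q\<^esub> v) \<in> \<Gamma>"
    and smult: "a \<in> G e \<Longrightarrow> (d, x, y) \<in> \<Gamma> \<Longrightarrow> (e + d, a \<odot>\<^bsub>N\<^esub> x, a \<odot>\<^bsub>Q\<^esub> y) \<in> \<Gamma>"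
    and at_zero: "(d, \<zero>\<^bsub>N\<^esub>, y) \<in> \<Gamma> \<Longrightarrow> y = \<zero>\<^bsub>Q\<^esub>"
begin

lemma dom_closed: "(d, x, y) \<in> \<Gamma> \<Longrightarrow> x \<in> carrier N"
  using dom N.M.homogeneous_closed by blast

lemma ran_closed: "(d, x, y) \<in> \<Gamma> \<Longrightarrow> y \<in> carrier Q"
  using ran Q.M.homogeneous_closed by blast

lemma minus:
  assumes "(d, x, y) \<in> \<Gamma>"
  shows "(d, \<ominus>\<^bsub>N\<^esub> x, \<ominus>\<^bsub>Q\<^esub> y) \<in> \<Gamma>"
  using smult[of "\<ominus>\<^bsub>R\<^esub> \<one>\<^bsub>R\<^esub>" 0 d x y] assms N.minus_homogeneous[OF N.one_homogeneous]
    dom_closed ran_closed N.minus_one_smult Q.minus_one_smult by auto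

lemma single_valued:
  assumes "(d, x, y) \<in> \<Gamma>" "(d, x, z) \<in> \<Gamma>"
  shows "y = z"
proof -
  have "(d, x \<oplus>\<^bsub>N\<^esub> \<ominus>\<^bsub>N\<^esub> x, y \<oplus>\<^bsub>Q\<^esub> \<ominus>\<^bsub>Q\<^esub> z) \<in> \<Gamma>"
    using assms minus add by blast
  then have "y \<oplus>\<^bsub>Q\<^esub> \<ominus>\<^bsub>Q\<^esub> z = \<zero>\<^bsub>Q\<^esub>"
    using at_zero dom_closed[OF assms(1)] by (simp add: N.M.r_neg)
  then have "\<ominus>\<^bsub>Q\<^esub> (\<ominus>\<^bsub>Q\<^esub> z) = y"
    using assms[THEN ran_closed] by (intro Q.M.minus_equality) auto
  then show ?thesis using assms[THEN ran_closed] by simp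
qed

lemma total_partial_hom:
  assumes total: "\<And>d x. x \<in> K d \<Longrightarrow> \<exists>y. (d, x, y) \<in> \<Gamma>"
  obtains g where "g \<in> graded_hom R N K Q L" and "\<And>d x y. (d, x, y) \<in> \<Gamma> \<Longrightarrow> g x = y"
proof -
  define g0 where "g0 d x = (THE y. (d, x, y) \<in> \<Gamma>)" for d x
  have g0: "g0 d x = y" if "(d, x, y) \<in> \<Gamma>" for d x y
    unfolding g0_def using that single_valued by blast
  obtain g where cl: "g \<in> carrier N \<rightarrow> carrier Q"
    and g_add: "\<And>x y. x \<in> carrier N \<Longrightarrow> y \<in> carrier N \<Longrightarrow> g (x \<oplus>\<^bsub>N\<^esub> y) = g x \<oplus>\<^bsub>Q\<^esub> g y"
    and g_hom: "\<And>d x. x \<in> K d \<Longrightarrow> g x = g0 d x"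
  proof (rule N.M.extend_additively[OF Q.M.abelian_group_axioms])
    show "g0 d x \<in> carrier Q" if "x \<in> K d" for d x
      using total[OF that] g0 ran_closed by metis
    show "g0 d (x \<oplus>\<^bsub>N\<^esub> y) = g0 d x \<oplus>\<^bsub>Q\<^esub> g0 d y" if "x \<in> K d" "y \<in> K d" for d x y
      using total[OF that(1)] total[OF that(2)] g0 add by metis
  qed blast
  have graph: "g x = y" if "(d, x, y) \<in> \<Gamma>" for d x y
    using that g0 g_hom dom by metis
  have gcl: "x \<in> carrier N \<Longrightarrow> g x \<in> carrier Q" for x using cl by blast
  have "g (a \<odot>\<^bsub>N\<^esub> x) = a \<odot>\<^bsub>Q\<^esub> g x" if a: "a \<in> carrier R" and x: "x \<in> carrier N" for a x
    using a
  proof (induction rule: N.homogeneous_induct)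
    case (homogeneous e a)
    then have a: "a \<in> carrier R" using N.homogeneous_closed by blast
    show ?case
      using x
    proof (induction rule: N.M.homogeneous_induct)
      case (homogeneous d x)
      then obtain y where "(d, x, y) \<in> \<Gamma>" using total by blast
      with graph smult[OF \<open>a \<in> G e\<close>] show ?case by metis
    next
      case (add x y)
      then show ?case
        using a gcl by (simp add: g_add N.smult_r_distr Q.smult_r_distr N.smult_closed)
    qed
  next
    case (add a b)
    then show ?case
      using x gcl by (simp add: g_add N.smult_l_distr Q.smult_l_distr N.smult_closed)
  qed
  moreover have "g ` K d \<subseteq> L d" for d
    using total graph ran by blast
  ultimately have "g \<in> graded_hom R N K Q L"
    unfolding graded_hom_def using cl g_add by blast
  then show ?thesis using graph that by blast
qed

text \<open>
  Adjoining \<open>x \<mapsto> y\<close> gives a well-defined homomorphism if \<open>y\<close> is compatible with the values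
  already given to those multiples of \<open>x\<close> which lie in the domain.
\<close>

lemma adjoin_element:
  assumes x: "x \<in> K d" and y: "y \<in> L d"
    and compatible: "\<And>n a z. a \<in> G n \<Longrightarrow> (n + d, a \<odot>\<^bsub>N\<^esub> x, z) \<in> \<Gamma> \<Longrightarrow> z = a \<odot>\<^bsub>Q\<^esub> y"
  obtains \<Delta> where "partial_hom R G N K Q L \<Delta>" "\<Gamma> \<subseteq> \<Delta>" "(d, x, y) \<in> \<Delta>"
proof
  define \<Delta> where "\<Delta> = {(n + d, u \<oplus>\<^bsub>N\<^esub> a \<odot>\<^bsub>N\<^esub> x, v \<oplus>\<^bsub>Q\<^esub> a \<odot>\<^bsub>Q\<^esub> y) | n u v a.
    a \<in> G n \<and> (n + d, u, v) \<in> \<Gamma>}"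
  have \<Delta>I: "(k, u', v') \<in> \<Delta>" if "k = n + d" "u' = u \<oplus>\<^bsub>N\<^esub> a \<odot>\<^bsub>N\<^esub> x" "v' = v \<oplus>\<^bsub>Q\<^esub> a \<odot>\<^bsub>Q\<^esub> y"
    "a \<in> G n" "(n + d, u, v) \<in> \<Gamma>" for k u' v' n u v a
    unfolding \<Delta>_def using that by blast
  have xc: "x \<in> carrier N" and yc: "y \<in> carrier Q"
    using x y N.M.homogeneous_closed Q.M.homogeneous_closed by auto
  have ac: "a \<in> carrier R" if "a \<in> G n" for a n using that N.homogeneous_closed by blast
  show sub: "\<Gamma> \<subseteq> \<Delta>"
  proof
    fix t assume "t \<in> \<Gamma>"
    moreover obtain k u v where t: "t = (k, u, v)" by (cases t)
    ultimately have "(k, u, v) \<in> \<Gamma>" by simp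
    then show "t \<in> \<Delta>"
      unfolding t using xc yc dom_closed ran_closed N.zero_homogeneous
      by (intro \<Delta>I[of _ "k - d" _ u "\<zero>\<^bsub>R\<^esub>" _ v]) (auto simp: N.zero_smult Q.zero_smult)
  qed
  show "(d, x, y) \<in> \<Delta>"
    using xc yc zero N.one_homogeneous
    by (intro \<Delta>I[of _ 0 _ "\<zero>\<^bsub>N\<^esub>" "\<one>\<^bsub>R\<^esub>" _ "\<zero>\<^bsub>Q\<^esub>"]) (auto simp: N.smult_one Q.smult_one)
  show "partial_hom R G N K Q L \<Delta>"
  proof unfold_locales
    fix k u' v' assume "(k, u', v') \<in> \<Delta>"
    then obtain n u v a where *: "k = n + d" "u' = u \<oplus>\<^bsub>N\<^esub> a \<odot>\<^bsub>N\<^esub> x" "v' = v \<oplus>\<^bsub>Q\<^esub> a \<odot>\<^bsub>Q\<^esub> y"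
      "a \<in> G n" "(n + d, u, v) \<in> \<Gamma>" unfolding \<Delta>_def by blast
    note a = ac[OF *(4)] and u = dom_closed[OF *(5)] and v = ran_closed[OF *(5)]
    show "u' \<in> K k"
      unfolding *(1,2) using * x dom
      by (intro N.M.add_homogeneous N.smult_homogeneous) auto
    show "v' \<in> L k"
      unfolding *(1,3) using * y ran
      by (intro Q.M.add_homogeneous Q.smult_homogeneous) auto
    show "(e + k, b \<odot>\<^bsub>N\<^esub> u', b \<odot>\<^bsub>Q\<^esub> v') \<in> \<Delta>" if b: "b \<in> G e" for e b
    proof (rule \<Delta>I)
      show "e + k = (e + n) + d" using * by simp
      show "b \<odot>\<^bsub>N\<^esub> u' = b \<odot>\<^bsub>N\<^esub> u \<oplus>\<^bsub>N\<^esub> (b \<otimes>\<^bsub>R\<^esub> a) \<odot>\<^bsub>N\<^esub> x"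
        using * a u ac[OF b] xc by (simp add: N.smult_r_distr N.smult_assoc1 N.smult_closed)
      show "b \<odot>\<^bsub>Q\<^esub> v' = b \<odot>\<^bsub>Q\<^esub> v \<oplus>\<^bsub>Q\<^esub> (b \<otimes>\<^bsub>R\<^esub> a) \<odot>\<^bsub>Q\<^esub> y"
        using * a v ac[OF b] yc by (simp add: Q.smult_r_distr Q.smult_assoc1 Q.smult_closed)
      show "b \<otimes>\<^bsub>R\<^esub> a \<in> G (e + n)" using b *(4) N.mult_homogeneous by blast
      show "(e + n + d, b \<odot>\<^bsub>N\<^esub> u, b \<odot>\<^bsub>Q\<^esub> v) \<in> \<Gamma>"
        using smult[OF b *(5)] by (simp add: add.assoc)
    qed
    show "(k, u' \<oplus>\<^bsub>N\<^esub> s', v' \<oplus>\<^bsub>Q\<^esub> t') \<in> \<Delta>" if "(k, s', t') \<in> \<Delta>" for s' t'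
    proof -
      from that obtain m s t b where st: "k = m + d" "s' = s \<oplus>\<^bsub>N\<^esub> b \<odot>\<^bsub>N\<^esub> x" "t' = t \<oplus>\<^bsub>Q\<^esub> b \<odot>\<^bsub>Q\<^esub> y"
        "b \<in> G m" "(m + d, s, t) \<in> \<Gamma>" unfolding \<Delta>_def by blast
      have mn: "m = n" using st(1) *(1) by simp
      note b = ac[OF st(4)] and s = dom_closed[OF st(5)] and t = ran_closed[OF st(5)]
      show ?thesis
      proof (rule \<Delta>I[OF *(1)])
        show "u' \<oplus>\<^bsub>N\<^esub> s' = (u \<oplus>\<^bsub>N\<^esub> s) \<oplus>\<^bsub>N\<^esub> (a \<oplus>\<^bsub>R\<^esub> b) \<odot>\<^bsub>N\<^esub> x"
          using a b u s xc N.smult_closed unfolding *(2) st(2)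
          by (simp add: N.smult_l_distr N.M.a_ac)
        show "v' \<oplus>\<^bsub>Q\<^esub> t' = (v \<oplus>\<^bsub>Q\<^esub> t) \<oplus>\<^bsub>Q\<^esub> (a \<oplus>\<^bsub>R\<^esub> b) \<odot>\<^bsub>Q\<^esub> y"
          using a b v t yc Q.smult_closed unfolding *(3) st(3)
          by (simp add: Q.smult_l_distr Q.M.a_ac)
        show "a \<oplus>\<^bsub>R\<^esub> b \<in> G n" using *(4) st(4) mn N.add_homogeneous by blast
        show "(n + d, u \<oplus>\<^bsub>N\<^esub> s, v \<oplus>\<^bsub>Q\<^esub> t) \<in> \<Gamma>" using *(5) st(5) mn add by blast
      qed
    qed
  next
    show "(k, \<zero>\<^bsub>N\<^esub>, \<zero>\<^bsub>Q\<^esub>) \<in> \<Delta>" for k using zero sub by blast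
  next
    fix k v' assume "(k, \<zero>\<^bsub>N\<^esub>, v') \<in> \<Delta>"
    then obtain n u v a where *: "k = n + d" "\<zero>\<^bsub>N\<^esub> = u \<oplus>\<^bsub>N\<^esub> a \<odot>\<^bsub>N\<^esub> x" "v' = v \<oplus>\<^bsub>Q\<^esub> a \<odot>\<^bsub>Q\<^esub> y"
      "a \<in> G n" "(n + d, u, v) \<in> \<Gamma>" unfolding \<Delta>_def by blast
    note a = ac[OF *(4)] and u = dom_closed[OF *(5)] and v = ran_closed[OF *(5)]
    have "a \<odot>\<^bsub>N\<^esub> x = \<ominus>\<^bsub>N\<^esub> u"
      using *(2) a u xc N.smult_closed
      by (metis N.M.a_comm N.M.minus_equality)
    then have "(n + d, a \<odot>\<^bsub>N\<^esub> x, \<ominus>\<^bsub>Q\<^esub> v) \<in> \<Gamma>" using minus[OF *(5)] by simp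
    then have "\<ominus>\<^bsub>Q\<^esub> v = a \<odot>\<^bsub>Q\<^esub> y" using compatible *(4) by blast
    then show "v' = \<zero>\<^bsub>Q\<^esub>" using *(3) v by (metis Q.M.r_neg)
  qed
qed

end

lemma partial_hom_Union_chain:
  assumes nonempty: "\<C> \<noteq> {}" and chain: "subset.chain {\<Gamma>. partial_hom R G N K Q L \<Gamma>} \<C>"
  shows "partial_hom R G N K Q L (\<Union>\<C>)"
proof -
  have ph: "partial_hom R G N K Q L \<Gamma>" if "\<Gamma> \<in> \<C>" for \<Gamma>
    using chain that by (auto simp: subset_chain_def)
  obtain \<Gamma>0 where \<Gamma>0: "\<Gamma>0 \<in> \<C>" using nonempty by blast
  interpret \<Gamma>0: partial_hom R G N K Q L \<Gamma>0 using ph[OF \<Gamma>0] .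
  show ?thesis
  proof unfold_locales
    show "(d, \<zero>\<^bsub>N\<^esub>, \<zero>\<^bsub>Q\<^esub>) \<in> \<Union>\<C>" for d using \<Gamma>0 \<Gamma>0.zero by blast
    show "(d, x \<oplus>\<^bsub>N\<^esub> u, y \<oplus>\<^bsub>Q\<^esub> v) \<in> \<Union>\<C>"
      if xy: "(d, x, y) \<in> \<Union>\<C>" and uv: "(d, u, v) \<in> \<Union>\<C>" for d x y u v
    proof -
      obtain \<Gamma> \<Gamma>' where *: "\<Gamma> \<in> \<C>" "\<Gamma>' \<in> \<C>" "(d, x, y) \<in> \<Gamma>" "(d, u, v) \<in> \<Gamma>'" using xy uv by blast
      then have "\<Gamma> \<subseteq> \<Gamma>' \<or> \<Gamma>' \<subseteq> \<Gamma>" using chain by (auto simp: subset_chain_def)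
      then obtain \<Gamma>'' where \<Gamma>'': "\<Gamma>'' \<in> \<C>" "(d, x, y) \<in> \<Gamma>''" "(d, u, v) \<in> \<Gamma>''" using * by blast
      from partial_hom.add[OF ph[OF \<Gamma>''(1)] \<Gamma>''(2,3)] \<Gamma>''(1) show ?thesis by blast
    qed
  qed (use ph[THEN partial_hom.dom] ph[THEN partial_hom.ran] ph[THEN partial_hom.smult]
      ph[THEN partial_hom.at_zero] in blast)+
qed

lemma partial_hom_of_injection:
  assumes M: "graded_module R G M H" and N: "graded_module R G N K" and Q: "graded_module R G Q L"
    and i: "i \<in> graded_hom R M H N K" and inj: "inj_on i (carrier M)"
    and f: "f \<in> graded_hom R M H Q L"
  shows "partial_hom R G N K Q L {(d, i x, f x) | d x. x \<in> H d}"
proof -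
  interpret M: graded_module R G M H by fact
  interpret N: graded_module R G N K by fact
  interpret Q: graded_module R G Q L by fact
  note i_hom = graded_homD[OF i] and f_hom = graded_homD[OF f]
  note i0 = graded_hom_zero[OF M N i] and f0 = graded_hom_zero[OF M Q f]
  show ?thesis (is "partial_hom _ _ _ _ _ _ ?\<Gamma>")
  proof unfold_locales
    fix d x y assume "(d, x, y) \<in> ?\<Gamma>"
    then obtain w where w: "x = i w" "y = f w" "w \<in> H d" by blast
    show "x \<in> K d" using w i_hom(4) by simp
    show "y \<in> L d" using w f_hom(4) by simp
    show "(e + d, a \<odot>\<^bsub>N\<^esub> x, a \<odot>\<^bsub>Q\<^esub> y) \<in> ?\<Gamma>" if a: "a \<in> G e" for e a
    proof -
      have "a \<odot>\<^bsub>M\<^esub> w \<in> H (e + d)" using a w M.smult_homogeneous by blast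
      moreover have "a \<odot>\<^bsub>N\<^esub> x = i (a \<odot>\<^bsub>M\<^esub> w)" "a \<odot>\<^bsub>Q\<^esub> y = f (a \<odot>\<^bsub>M\<^esub> w)"
        using w i_hom(3)[of a w] f_hom(3)[of a w] M.homogeneous_closed[OF a]
          M.M.homogeneous_closed[of w d] by simp_all
      ultimately show ?thesis by blast
    qed
    show "(d, x \<oplus>\<^bsub>N\<^esub> u, y \<oplus>\<^bsub>Q\<^esub> v) \<in> ?\<Gamma>" if uv: "(d, u, v) \<in> ?\<Gamma>" for u v
    proof -
      obtain t where t: "u = i t" "v = f t" "t \<in> H d" using uv by blast
      have "w \<oplus>\<^bsub>M\<^esub> t \<in> H d" using t w M.M.add_homogeneous by blast
      moreover have "x \<oplus>\<^bsub>N\<^esub> u = i (w \<oplus>\<^bsub>M\<^esub> t)" "y \<oplus>\<^bsub>Q\<^esub> v = f (w \<oplus>\<^bsub>M\<^esub> t)"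
        using w t i_hom(2)[of w t] f_hom(2)[of w t] M.M.homogeneous_closed[of _ d] by simp_all
      ultimately show ?thesis by blast
    qed
  next
    show "(d, \<zero>\<^bsub>N\<^esub>, \<zero>\<^bsub>Q\<^esub>) \<in> ?\<Gamma>" for d
      using i0 f0 M.M.zero_homogeneous[of d] by force
  next
    fix d y assume "(d, \<zero>\<^bsub>N\<^esub>, y) \<in> ?\<Gamma>"
    then obtain w where w: "i w = \<zero>\<^bsub>N\<^esub>" "y = f w" "w \<in> H d" by auto
    then have "w = \<zero>\<^bsub>M\<^esub>"
      using inj_onD[OF inj, of w "\<zero>\<^bsub>M\<^esub>"] i0 M.M.homogeneous_closed[of w d] by simp
    then show "y = \<zero>\<^bsub>Q\<^esub>" using w f0 by simp
  qed
qed

lemma graded_module_shift: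
  assumes "graded_module R G M H"
  shows "graded_module R G M (\<lambda>n. H (n + d))"
proof -
  interpret graded_module R G M H by fact
  have "direct_sum_grading M (\<lambda>n. H (n + d))"
  proof (rule direct_sum_gradingI[where \<pi> = "\<lambda>n x. M.component x (n + d)"])
    fix P x
    assume x: "x \<in> carrier M" and hom: "\<And>n x. x \<in> H (n + d) \<Longrightarrow> P x"
      and add: "\<And>x y. x \<in> carrier M \<Longrightarrow> y \<in> carrier M \<Longrightarrow> P x \<Longrightarrow> P y \<Longrightarrow> P (x \<oplus>\<^bsub>M\<^esub> y)"
    show "P x"
      using x
    proof (induction rule: M.homogeneous_induct)
      case (homogeneous e x)
      then show ?case using hom[of x "e - d"] by simp
    qed (rule add)
  qed (auto simp: M.abelian_group_axioms M.homogeneous_subgroup M.component_homogeneous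
      M.component_add M.component_of_homogeneous)
  then show ?thesis
    using smult_homogeneous
    by unfold_locales (auto simp: smult_closed smult_l_distr smult_r_distr smult_assoc1 smult_one
        add.assoc)
qed

text \<open>
  A maximal partial homomorphism is total: for \<open>x\<close> of degree \<open>d\<close>, the
  homogeneous scalars that carry \<open>x\<close> into its domain are those of an ideal of \<open>R\<close>. On this ideal
  the partial homomorphism induces one of degree \<open>d\<close>, which the criterion extends to \<open>R\<close>; its
  value at \<open>1\<close> is a possible value at \<open>x\<close>. The hypothesis expresses the degree \<open>d\<close> by shifting
  the grading of \<open>Q\<close>.
\<close>

theorem graded_baer_criterion:
  fixes Q :: "('a, 'q) module"
  assumes Q: "graded_module R G Q L"
    and criterion: "\<And>d \<Phi>. partial_hom R G (ideal_module R (carrier R)) G Q (\<lambda>n. L (n + d)) \<Phi> \<Longrightarrow>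
      \<exists>y\<in>L d. \<forall>(n, a, z)\<in>\<Phi>. z = a \<odot>\<^bsub>Q\<^esub> y"
  shows "graded_injective TYPE('m) TYPE('n) R G Q L"
  unfolding graded_injective_def
proof (intro conjI allI impI Q)
  fix M :: "('a, 'm) module" and H and N :: "('a, 'n) module" and K i f
  assume "graded_module R G M H \<and> graded_module R G N K \<and>
    i \<in> graded_hom R M H N K \<and> inj_on i (carrier M) \<and> f \<in> graded_hom R M H Q L"
  then have M: "graded_module R G M H" and N: "graded_module R G N K"
    and i: "i \<in> graded_hom R M H N K" and inj: "inj_on i (carrier M)"
    and f: "f \<in> graded_hom R M H Q L" by auto
  let ?\<Gamma>0 = "{(d, i x, f x) | d x. x \<in> H d}"
  let ?\<A> = "{\<Gamma>. partial_hom R G N K Q L \<Gamma> \<and> ?\<Gamma>0 \<subseteq> \<Gamma>}"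
  have "\<exists>\<Gamma>\<in>?\<A>. \<forall>\<Delta>\<in>?\<A>. \<Gamma> \<subseteq> \<Delta> \<longrightarrow> \<Delta> = \<Gamma>"
  proof (rule subset_Zorn_nonempty)
    have "?\<Gamma>0 \<in> ?\<A>" using partial_hom_of_injection[OF M N Q i inj f] by simp
    then show "?\<A> \<noteq> {}" by (rule ex_in_conv[THEN iffD1, OF exI])
    fix \<C> assume C: "\<C> \<noteq> {}" "subset.chain ?\<A> \<C>"
    then have "subset.chain {\<Gamma>. partial_hom R G N K Q L \<Gamma>} \<C>"
      by (auto simp: subset_chain_def)
    then have "partial_hom R G N K Q L (\<Union>\<C>)" by (rule partial_hom_Union_chain[OF C(1)])
    moreover have "?\<Gamma>0 \<subseteq> \<Union>\<C>"
    proof -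
      obtain \<Gamma> where "\<Gamma> \<in> \<C>" using C(1) by blast
      moreover from this have "?\<Gamma>0 \<subseteq> \<Gamma>" using C(2) unfolding subset_chain_def by blast
      ultimately show ?thesis by blast
    qed
    ultimately show "\<Union>\<C> \<in> ?\<A>" by simp
  qed
  then obtain \<Gamma> where "\<Gamma> \<in> ?\<A>" and max: "\<forall>\<Delta>\<in>?\<A>. \<Gamma> \<subseteq> \<Delta> \<longrightarrow> \<Delta> = \<Gamma>" ..
  then have \<Gamma>: "partial_hom R G N K Q L \<Gamma>" "?\<Gamma>0 \<subseteq> \<Gamma>" by simp_all
  have maximal: "\<Delta> = \<Gamma>" if "partial_hom R G N K Q L \<Delta>" "\<Gamma> \<subseteq> \<Delta>" for \<Delta>
  proof -
    have "\<Delta> \<in> ?\<A>" using that(1) order_trans[OF \<Gamma>(2) that(2)] by simp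
    then show ?thesis using max that(2) by simp
  qed
  interpret \<Gamma>: partial_hom R G N K Q L \<Gamma> by fact
  interpret Rm: graded_module R G "ideal_module R (carrier R)" G
    by (rule \<Gamma>.N.graded_module_self)
  have total: "\<exists>y. (d, x, y) \<in> \<Gamma>" if x: "x \<in> K d" for d x
  proof -
    let ?\<Phi> = "{(n, a, z). a \<in> G n \<and> (n + d, a \<odot>\<^bsub>N\<^esub> x, z) \<in> \<Gamma>}"
    interpret Qd: graded_module R G Q "\<lambda>n. L (n + d)" by (rule graded_module_shift[OF Q])
    have xc: "x \<in> carrier N" using x \<Gamma>.N.M.homogeneous_closed by blast
    have "partial_hom R G (ideal_module R (carrier R)) G Q (\<lambda>n. L (n + d)) ?\<Phi>"
    proof unfold_locales
      show "(n, \<zero>\<^bsub>ideal_module R (carrier R)\<^esub>, \<zero>\<^bsub>Q\<^esub>) \<in> ?\<Phi>" for n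
        using xc \<Gamma>.zero \<Gamma>.N.zero_homogeneous by (simp add: \<Gamma>.N.zero_smult)
    next
      fix n a z b w assume "(n, a, z) \<in> ?\<Phi>" "(n, b, w) \<in> ?\<Phi>"
      then show "(n, a \<oplus>\<^bsub>ideal_module R (carrier R)\<^esub> b, z \<oplus>\<^bsub>Q\<^esub> w) \<in> ?\<Phi>"
        using xc \<Gamma>.add[of "n + d"] \<Gamma>.N.add_homogeneous \<Gamma>.N.homogeneous_closed
        by (auto simp: \<Gamma>.N.smult_l_distr)
    next
      fix b e n a z assume "b \<in> G e" "(n, a, z) \<in> ?\<Phi>"
      then show "(e + n, b \<odot>\<^bsub>ideal_module R (carrier R)\<^esub> a, b \<odot>\<^bsub>Q\<^esub> z) \<in> ?\<Phi>"
        using xc \<Gamma>.smult[of b e "n + d"] \<Gamma>.N.mult_homogeneous \<Gamma>.N.homogeneous_closed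
        by (auto simp: \<Gamma>.N.smult_assoc1 add.assoc)
    next
      fix n z assume "(n, \<zero>\<^bsub>ideal_module R (carrier R)\<^esub>, z) \<in> ?\<Phi>"
      then show "z = \<zero>\<^bsub>Q\<^esub>"
        using xc \<Gamma>.at_zero by (auto simp: \<Gamma>.N.zero_smult)
    qed (auto dest: \<Gamma>.ran)
    from criterion[OF this] obtain y where y: "y \<in> L d" "\<forall>(n, a, z)\<in>?\<Phi>. z = a \<odot>\<^bsub>Q\<^esub> y" by blast
    have "z = a \<odot>\<^bsub>Q\<^esub> y" if "a \<in> G n" "(n + d, a \<odot>\<^bsub>N\<^esub> x, z) \<in> \<Gamma>" for n a z
      using y(2) that by simp
    then obtain \<Delta> where "partial_hom R G N K Q L \<Delta>" "\<Gamma> \<subseteq> \<Delta>" "(d, x, y) \<in> \<Delta>"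
      using \<Gamma>.adjoin_element[OF x y(1)] by metis
    then show ?thesis using maximal[of \<Delta>] by auto
  qed
  obtain g where g: "g \<in> graded_hom R N K Q L" and graph: "\<And>d x y. (d, x, y) \<in> \<Gamma> \<Longrightarrow> g x = y"
    using \<Gamma>.total_partial_hom[OF total] by blast
  interpret M: graded_module R G M H by fact
  have "g (i x) = f x" if "x \<in> carrier M" for x
    using that
  proof (induction rule: M.M.homogeneous_induct)
    case (homogeneous d x)
    then have "(d, i x, f x) \<in> ?\<Gamma>0" by blast
    then show ?case by (rule graph[OF subsetD[OF \<Gamma>(2)]])
  next
    case (add x y)
    moreover have "i x \<in> carrier N" "i y \<in> carrier N" using add i by (auto simp: graded_hom_def)
    ultimately show ?case using g i f by (simp add: graded_hom_def)
  qed
  with g show "\<exists>g\<in>graded_hom R N K Q L. \<forall>x\<in>carrier M. g (i x) = f x" by blast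
qed

section \<open>The algebra spanned by square-free monomials, and its self-injectivity\<close>

lemma set_encode_Un_disjoint:
  "finite A \<Longrightarrow> finite B \<Longrightarrow> A \<inter> B = {} \<Longrightarrow> set_encode (A \<union> B) = set_encode A + set_encode B"
  by (simp add: set_encode_def sum.union_disjoint)

lemma set_encode_Diff_subset:
  assumes "finite A" "B \<subseteq> A"
  shows "set_encode (A - B) + set_encode B = set_encode A"
proof -
  have "(A - B) \<inter> B = {}" by blast
  then have "set_encode (A - B \<union> B) = set_encode (A - B) + set_encode B"
    using assms finite_subset by (intro set_encode_Un_disjoint) auto
  then show ?thesis using assms(2) by (simp add: Un_absorb2)
qed

text \<open>
  The exterior algebra over the two-element field, seen through its monomials: \<open>e A\<close> stands for
  the product of the generators \<open>x\<^sub>i\<close> with \<open>i \<in> A\<close>. Its degree is the sum of the \<open>2 ^ i\<close>, that is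
  \<open>set_encode A\<close>. As binary expansions are unique, a non-zero homogeneous element is a monomial and is
  determined by its degree; the proofs below depend on this throughout.
\<close>

locale binary_exterior_algebra = cring R for R :: "('a, 'r) ring_scheme" (structure) +
  fixes G :: "int \<Rightarrow> 'a set" and e :: "nat set \<Rightarrow> 'a"
  assumes direct_sum: "direct_sum_grading R G"
    and homogeneous_part: "G d = insert \<zero> {e A | A. finite A \<and> int (set_encode A) = d}"
    and e_mult: "finite A \<Longrightarrow> finite B \<Longrightarrow>
      e A \<otimes> e B = (if A \<inter> B = {} then e (A \<union> B) else \<zero>)"
    and e_empty: "e {} = \<one>"
    and e_nonzero: "finite A \<Longrightarrow> e A \<noteq> \<zero>"
    and double_zero: "x \<in> carrier R \<Longrightarrow> x \<oplus> x = \<zero>"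
begin

lemma minus_eq_self: "x \<in> carrier R \<Longrightarrow> \<ominus> x = x"
  using double_zero by (intro minus_equality) auto

lemma e_homogeneous: "finite A \<Longrightarrow> e A \<in> G (int (set_encode A))"
  by (auto simp: homogeneous_part)

end

sublocale binary_exterior_algebra \<subseteq> graded_ring R G
proof
  interpret graded_group R G by unfold_locales (rule direct_sum)
  show "direct_sum_grading R G" by (rule direct_sum)
  show "\<one> \<in> G 0" using e_homogeneous[of "{}"] by (simp add: e_empty)
  fix a b c d assume a: "a \<in> G c" and b: "b \<in> G d"
  have cl: "a \<in> carrier R" "b \<in> carrier R" using a b homogeneous_closed by auto
  then show "a \<otimes> b = (if odd c \<and> odd d then \<ominus> (b \<otimes> a) else b \<otimes> a)"
    by (simp add: minus_eq_self m_comm)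
  show "a \<otimes> b \<in> G (c + d)"
  proof (cases "a = \<zero> \<or> b = \<zero>")
    case True
    then show ?thesis using cl zero_homogeneous by auto
  next
    case False
    then obtain A B where "finite A" "int (set_encode A) = c" "a = e A"
      "finite B" "int (set_encode B) = d" "b = e B"
      using a b unfolding homogeneous_part by blast
    then show ?thesis
      using e_homogeneous[of "A \<union> B"]
      by (auto simp: e_mult zero_homogeneous set_encode_Un_disjoint)
  qed
qed

context binary_exterior_algebra
begin

lemma e_closed: "finite A \<Longrightarrow> e A \<in> carrier R"
  using e_homogeneous homogeneous_closed by blast

lemma homogeneousE:
  assumes "x \<in> G d" "x \<noteq> \<zero>"
  obtains A where "finite A" "int (set_encode A) = d" "x = e A"
  using assms unfolding homogeneous_part by blast

text \<open>
  A non-zero value \<open>e C\<close> at \<open>e B\<close> must be killed by each \<open>e {i}\<close> with \<open>i \<in> B\<close>, because \<open>e B\<close> is. This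
  forces \<open>B \<subseteq> C\<close>, so that \<open>e C = e B \<otimes> e (C - B)\<close>, and the set \<open>D = C - B\<close> is the one encoded by
  the degree of the homomorphism: it does not depend on \<open>B\<close>.
\<close>

lemma partial_hom_is_multiplication:
  assumes "partial_hom R G (ideal_module R (carrier R)) G (ideal_module R (carrier R))
    (\<lambda>n. G (n + d)) \<Phi>"
  shows "\<exists>y\<in>G d. \<forall>(n, a, z)\<in>\<Phi>. z = a \<otimes> y"
proof -
  interpret \<Phi>: partial_hom R G "ideal_module R (carrier R)" G "ideal_module R (carrier R)"
    "\<lambda>n. G (n + d)" \<Phi> by fact
  have smult: "(k + n, c \<otimes> a, c \<otimes> z) \<in> \<Phi>" if "c \<in> G k" "(n, a, z) \<in> \<Phi>" for k n c a z
    using \<Phi>.smult[OF that] by simp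
  have at_zero: "z = \<zero>" if "(n, \<zero>, z) \<in> \<Phi>" for n z
    using \<Phi>.at_zero that by simp
  have nonzero_value: "\<exists>B D. finite B \<and> finite D \<and> B \<inter> D = {} \<and> int (set_encode D) = d \<and>
      n = int (set_encode B) \<and> a = e B \<and> z = e (B \<union> D)"
    if az: "(n, a, z) \<in> \<Phi>" and z: "z \<noteq> \<zero>" for n a z
  proof -
    have "a \<noteq> \<zero>" using az z at_zero by auto
    then obtain B where B: "finite B" "int (set_encode B) = n" "a = e B"
      using \<Phi>.dom[OF az] homogeneousE by blast
    obtain C where C: "finite C" "int (set_encode C) = n + d" "z = e C"
      using \<Phi>.ran[OF az] z homogeneousE by blast
    have "B \<subseteq> C"
    proof
      fix i assume i: "i \<in> B"
      have "e {i} \<otimes> a = \<zero>" using B i by (simp add: e_mult)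
      then have "e {i} \<otimes> z = \<zero>"
        using smult[OF e_homogeneous az, of "{i}"] at_zero by simp
      then show "i \<in> C" using C e_nonzero[of "{i} \<union> C"] by (auto simp: e_mult split: if_splits)
    qed
    moreover from this have "int (set_encode (C - B)) = d"
      using set_encode_Diff_subset[of C B] B C by linarith
    ultimately show ?thesis
      using B C by (intro exI[of _ B] exI[of _ "C - B"]) (auto simp: Un_absorb1)
  qed
  show ?thesis
  proof (cases "\<forall>(n, a, z)\<in>\<Phi>. z = \<zero>")
    case True
    then have "z = a \<otimes> \<zero>" if "(n, a, z) \<in> \<Phi>" for n a z
      using that homogeneous_closed[OF \<Phi>.dom[OF that]] by auto
    then show ?thesis using zero_homogeneous[of d] by auto
  next
    case False
    then obtain n a z where az: "(n, a, z) \<in> \<Phi>" "z \<noteq> \<zero>" by blast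
    from nonzero_value[OF this] obtain B D where B: "finite B" "a = e B" "n = int (set_encode B)"
      and D: "finite D" "int (set_encode D) = d" and BD: "B \<inter> D = {}" "z = e (B \<union> D)" by blast
    have "w = b \<otimes> e D" if bw: "(m, b, w) \<in> \<Phi>" for m b w
    proof (cases "w = \<zero>")
      case False
      from nonzero_value[OF bw False] obtain B' D' where B': "finite B'" "b = e B'"
        and D': "finite D'" "int (set_encode D') = d" and BD': "B' \<inter> D' = {}" "w = e (B' \<union> D')"
        by blast
      have "D' = D" using D D' set_encode_eq[of D' D] by simp
      then show ?thesis using B' D BD' by (simp add: e_mult)
    next
      case True
      \<comment> \<open>If \<open>e D\<close> does not kill \<open>b = e B'\<close>, then the values at \<open>e B\<close> and at \<open>e B'\<close> give different
        values at \<open>e (B \<union> B')\<close>.\<close>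
      show ?thesis
      proof (rule ccontr)
        assume neq: "w \<noteq> b \<otimes> e D"
        then have "b \<noteq> \<zero>" using True e_closed[OF D(1)] by auto
        then obtain B' where B': "finite B'" "int (set_encode B') = m" "b = e B'"
          using \<Phi>.dom[OF bw] homogeneousE by blast
        then have B'D: "B' \<inter> D = {}" using neq True D by (auto simp: e_mult split: if_splits)
        define U where "U = B \<union> B'"
        have *: "(B' - B) \<inter> B = {}" "B' - B \<union> B = U" "(B - B') \<inter> B' = {}" "B - B' \<union> B' = U"
          "(B' - B) \<inter> (B \<union> D) = {}" "B' - B \<union> (B \<union> D) = U \<union> D"
          using B'D unfolding U_def by auto
        have deg: "int (set_encode (B' - B)) + n = int (set_encode U)"
          "int (set_encode (B - B')) + m = int (set_encode U)"
          using set_encode_Un_disjoint[of "B' - B" B] set_encode_Un_disjoint[of "B - B'" B'] B B' *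
          by auto
        have "(int (set_encode U), e U, e (U \<union> D)) \<in> \<Phi>"
          using smult[OF e_homogeneous az(1), of "B' - B"] B B' D BD * deg by (simp add: e_mult)
        moreover have "(int (set_encode U), e U, \<zero>) \<in> \<Phi>"
          using smult[OF e_homogeneous bw, of "B - B'"] B B' * deg True
          by (simp add: e_mult e_closed)
        ultimately have "e (U \<union> D) = \<zero>" using \<Phi>.single_valued by blast
        then show False using e_nonzero[of "U \<union> D"] B B' D by (simp add: U_def)
      qed
    qed
    then show ?thesis using D e_homogeneous[of D] by (intro bexI[of _ "e D"]) auto
  qed
qed

theorem self_injective: "graded_self_injective TYPE('m) TYPE('n) R G"
  unfolding graded_self_injective_def
proof (rule graded_baer_criterion)
  show "graded_module R G (ideal_module R (carrier R)) G" by (rule graded_module_self)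
  fix d \<Phi>
  assume "partial_hom R G (ideal_module R (carrier R)) G (ideal_module R (carrier R))
    (\<lambda>n. G (n + d)) \<Phi>"
  from partial_hom_is_multiplication[OF this]
  show "\<exists>y\<in>G d. \<forall>(n, a, z)\<in>\<Phi>. z = a \<odot>\<^bsub>ideal_module R (carrier R)\<^esub> y" by simp
qed

end

section \<open>The reduced quotient\<close>

context binary_exterior_algebra
begin

text \<open>
  In characteristic two squaring is additive, and it sends every monomial except \<open>e {} = 1\<close> to
  zero. Hence the component of degree \<open>0\<close> is multiplicative, and an element is nilpotent if and only
  if this component vanishes.
\<close>

lemma mult_self_eq_component:
  assumes "x \<in> carrier R"
  shows "x \<otimes> x = component x 0"
  using assms
proof (induction rule: homogeneous_induct)
  case (homogeneous d x)
  show ?case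
  proof (cases "x = \<zero>")
    case False
    then obtain A where A: "finite A" "int (set_encode A) = d" "x = e A"
      using homogeneous homogeneousE by blast
    have "x \<otimes> x = (if A = {} then x else \<zero>)"
      using A by (simp add: e_mult)
    moreover have "component x 0 = (if d = 0 then x else \<zero>)"
      using component_of_homogeneous[OF homogeneous] by simp
    moreover have "d = 0 \<longleftrightarrow> A = {}"
      using A(1,2) set_encode_eq[of A "{}"] by force
    ultimately show ?thesis by simp
  qed (simp add: component_zero)
next
  case (add x y)
  have "(x \<oplus> y) \<otimes> (x \<oplus> y) = x \<otimes> x \<oplus> y \<otimes> y \<oplus> (x \<otimes> y \<oplus> x \<otimes> y)"
    using add.hyps by (simp add: l_distr r_distr a_ac m_comm)
  with add show ?case by (simp add: double_zero component_add component_closed)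
qed

lemma component_0_cases:
  assumes "x \<in> carrier R"
  shows "component x 0 = \<zero> \<or> component x 0 = \<one>"
proof (cases "component x 0 = \<zero>")
  case False
  with component_homogeneous[OF assms] obtain A
    where "finite A" "int (set_encode A) = 0" "component x 0 = e A" by (rule homogeneousE)
  then show ?thesis using set_encode_eq[of A "{}"] e_empty by simp
qed simp

lemma one_neq_zero: "\<one> \<noteq> \<zero>"
  using e_nonzero[of "{}"] by (simp add: e_empty)

definition augmentation :: "'a \<Rightarrow> bit" where
  "augmentation x = (if component x 0 = \<zero> then 0 else 1)"

lemma augmentation_ring_hom: "ring_hom_ring R F2 augmentation"
proof (rule ring_hom_ringI2)
  show "ring R" by (rule ring_axioms)
  show "ring F2" by (rule ring_from_type_algebra)
  show "augmentation \<in> ring_hom R F2"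
  proof (rule ring_hom_memI)
    fix x y assume x: "x \<in> carrier R" and y: "y \<in> carrier R"
    have "component (x \<otimes> y) 0 = (x \<otimes> y) \<otimes> (x \<otimes> y)"
      using x y by (simp add: mult_self_eq_component)
    also have "\<dots> = (x \<otimes> x) \<otimes> (y \<otimes> y)"
      using x y by (simp add: m_ac)
    finally have "component (x \<otimes> y) 0 = component x 0 \<otimes> component y 0"
      using x y by (simp add: mult_self_eq_component)
    then show "augmentation (x \<otimes> y) = augmentation x \<otimes>\<^bsub>F2\<^esub> augmentation y"
      using component_0_cases[OF x] component_0_cases[OF y]
      by (auto simp: augmentation_def ring_of_type_algebra_def)
    show "augmentation (x \<oplus> y) = augmentation x \<oplus>\<^bsub>F2\<^esub> augmentation y"
      using component_0_cases[OF x] component_0_cases[OF y] x y one_neq_zero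
      by (auto simp: augmentation_def ring_of_type_algebra_def component_add double_zero)
  next
    show "augmentation \<one> = \<one>\<^bsub>F2\<^esub>"
      using one_neq_zero one_homogeneous
      by (simp add: augmentation_def ring_of_type_algebra_def component_of_homogeneous)
  qed (simp add: ring_of_type_algebra_def)
qed

lemma augmentation_homogeneous_part: "augmentation ` G d = concentrated_grading F2 d"
proof (cases "d = 0")
  case True
  have "augmentation \<zero> = 0" "augmentation \<one> = 1"
    using one_neq_zero one_homogeneous
    by (simp_all add: augmentation_def component_zero component_of_homogeneous)
  then have "0 \<in> augmentation ` G 0" "1 \<in> augmentation ` G 0"
    using imageI[OF zero_homogeneous[of 0], of augmentation] imageI[OF one_homogeneous, of augmentation]
    by simp_all
  then have "b \<in> augmentation ` G 0" for b by (cases b) simp_all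
  then show ?thesis
    using True by (auto simp: concentrated_grading_def ring_of_type_algebra_def)
next
  case False
  then have "augmentation x = 0" if "x \<in> G d" for x
    using that by (simp add: augmentation_def component_of_homogeneous)
  then show ?thesis
    using False zero_homogeneous[of d]
    by (auto simp: concentrated_grading_def ring_of_type_algebra_def image_iff)
qed

lemma augmentation_kernel: "a_kernel R F2 augmentation = nilradical R"
proof (intro equalityI subsetI)
  fix x assume "x \<in> a_kernel R F2 augmentation"
  then have x: "x \<in> carrier R" "component x 0 = \<zero>"
    by (auto simp: a_kernel_def' augmentation_def ring_of_type_algebra_def split: if_splits)
  then have "x [^] (2::nat) = \<zero>" by (simp add: numeral_2_eq_2 mult_self_eq_component)
  with x show "x \<in> nilradical R" by (auto simp: nilradical_def)
next
  fix x assume "x \<in> nilradical R"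
  then obtain n :: nat where x: "x \<in> carrier R" "x [^] n = \<zero>" by (auto simp: nilradical_def)
  have "component x 0 \<noteq> \<one>"
  proof
    assume "component x 0 = \<one>"
    then have "\<one> = (x \<otimes> x) [^] n" using x by (simp add: mult_self_eq_component)
    also have "\<dots> = \<zero>" using x by (simp add: nat_pow_distrib)
    finally show False using one_neq_zero by simp
  qed
  then show "x \<in> a_kernel R F2 augmentation"
    using x component_0_cases[of x]
    by (auto simp: a_kernel_def' augmentation_def ring_of_type_algebra_def)
qed

theorem reduced_quotient:
  "\<exists>h. h \<in> graded_ring_iso (R Quot nilradical R) (quotient_grading R (nilradical R) G)
    F2 (concentrated_grading F2)"
proof -
  interpret h: ring_hom_ring R F2 augmentation by (rule augmentation_ring_hom)
  let ?h = "\<lambda>C. the_elem (augmentation ` C)"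
  have "augmentation ` carrier R = carrier F2"
  proof
    have "carrier F2 = concentrated_grading F2 0" by (simp add: concentrated_grading_def)
    then show "carrier F2 \<subseteq> augmentation ` carrier R"
      using augmentation_homogeneous_part[of 0] homogeneous_closed by blast
  qed (simp add: ring_of_type_algebra_def)
  then have "?h \<in> ring_iso (R Quot nilradical R) F2"
    using h.FactRing_iso_set by (simp add: augmentation_kernel)
  moreover have "?h ` quotient_grading R (nilradical R) G d = concentrated_grading F2 d" for d
  proof -
    have "?h ` quotient_grading R (nilradical R) G d = augmentation ` G d"
      unfolding quotient_grading_def image_image
      using h.the_elem_simp homogeneous_closed by (intro image_cong) (auto simp: augmentation_kernel)
    then show ?thesis by (simp add: augmentation_homogeneous_part)
  qed
  ultimately show ?thesis by (auto simp: graded_ring_iso_def)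
qed

end

section \<open>Coherence\<close>

context binary_exterior_algebra
begin

text \<open>
  Let \<open>q\<close> map the free module onto the ideal and let \<open>b i a\<close> be \<open>a\<close> times its \<open>i\<close>-th basis vector.
  The relations are the evident ones: \<open>e {k}\<close> kills \<open>e (A i)\<close> for \<open>k \<in> A i\<close> (below, \<open>kill\<close>), and
  \<open>e (A i)\<close>, \<open>e (A j)\<close> have the common multiple \<open>e (A i \<union> A j)\<close> (below, \<open>swap\<close>). Modulo these,
  \<open>b i (e B)\<close> depends only on its image in the ideal: it vanishes if the image does, and
  otherwise the image is some \<open>e C\<close>, and \<open>b i (e B)\<close> is congruent to the vector \<open>\<sigma> C\<close> that is
  made from one chosen \<open>A j\<close> contained in \<open>C\<close>. With \<open>s\<close> the additive map that sends \<open>e C\<close> to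
  \<open>\<sigma> C\<close>, every vector \<open>v\<close> is therefore congruent to \<open>s (q v)\<close>, and so to zero if \<open>q v\<close> is zero.
\<close>

lemma monomial_ideal_finitely_presented:
  fixes As :: "nat set list"
  defines "I \<equiv> Idl (e ` set As)"
  assumes fin: "\<And>A. A \<in> set As \<Longrightarrow> finite A"
  shows "finitely_presented R G (ideal_module R I) (\<lambda>d. I \<inter> G d)"
proof -
  note [simp del] = free_module_simps
  define r where "r = length As"
  define ds where "ds = map (\<lambda>A. int (set_encode A)) As"
  define F where "F = free_module R ds"
  define b where "b i a = coordinate_vector R ds i a" for i a
  let ?M = "ideal_module R I" and ?FG = "free_grading G ds" and ?H = "\<lambda>d. I \<inter> G d"
  have len: "length ds = r" by (simp add: ds_def r_def)
  have finA: "finite (As ! i)" if "i < r" for i using that fin by (simp add: r_def)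
  have ds_nth: "ds ! i = int (set_encode (As ! i))" if "i < r" for i
    using that by (simp add: ds_def r_def)
  have S: "e ` set As \<subseteq> (\<Union>d. G d)" using fin e_homogeneous by blast
  then have Scl: "e ` set As \<subseteq> carrier R" using homogeneous_closed by blast
  interpret I: ideal I R unfolding I_def using Scl by (rule genideal_ideal)
  have SI: "e ` set As \<subseteq> I" unfolding I_def using Scl by (rule genideal_self)
  have M: "graded_module R G ?M ?H"
    by (rule graded_module_ideal[OF I.ideal_axioms]) (use component_in_genideal[OF S] in \<open>simp add: I_def\<close>)
  have Fm: "graded_module R G F ?FG" unfolding F_def by (rule graded_module_free)
  interpret M: graded_module R G ?M ?H by (rule M)
  interpret F: graded_module R G F ?FG by (rule Fm)
  have bcl: "b i a \<in> carrier F" if "a \<in> carrier R" for i a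
    using that coordinate_vector_closed by (simp add: b_def F_def)
  have b_smult: "a \<odot>\<^bsub>F\<^esub> b i c = b i (a \<otimes> c)" if "a \<in> carrier R" "c \<in> carrier R" for a c i
    using that smult_coordinate_vector by (simp add: b_def F_def)
  have b_zero: "b i \<zero> = \<zero>\<^bsub>F\<^esub>" for i
    by (auto simp: b_def F_def coordinate_vector_def free_module_simps)
  have b_hom: "b i (e B) \<in> ?FG (int (set_encode B) + int (set_encode (As ! i)))"
    if "finite B" "i < r" for B i
    using that coordinate_vector_homogeneous[OF e_homogeneous] by (simp add: b_def len ds_nth[symmetric])
  have F_double: "v \<oplus>\<^bsub>F\<^esub> v = \<zero>\<^bsub>F\<^esub>" if "v \<in> carrier F" for v
    using that double_zero by (auto simp: F_def PiE_iff fun_eq_iff free_module_simps)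

  define q where "q = linear_combination ?M (map e As)"
  have ts: "map e As ! i \<in> ?H (ds ! i)" if "i < length ds" for i
    using that SI finA e_homogeneous ds_nth by (auto simp: len r_def)
  have q: "q \<in> graded_hom R F ?FG ?M ?H"
    unfolding q_def F_def by (rule M.linear_combination_hom) (use ts in \<open>simp_all add: ds_def\<close>)
  have q_b: "q (b i a) = a \<otimes> e (As ! i)" if "i < r" "a \<in> carrier R" for i a
    using M.linear_combination_coordinate_vector[of "map e As" ds i a] ts that
    by (simp add: q_def b_def ds_def r_def)
  note q_cl = graded_homD(1)[OF q, simplified] and q_add = graded_homD(2)[OF q, simplified]
    and q_smult = graded_homD(3)[OF q, simplified]
  have q_zero: "q \<zero>\<^bsub>F\<^esub> = \<zero>" using graded_hom_zero[OF Fm M q] by simp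

  define kill where "kill i k = b i (e {k})" for i k :: nat
  define swap where "swap i j = b i (e (As ! j - As ! i)) \<oplus>\<^bsub>F\<^esub> b j (e (As ! i - As ! j))" for i j
  define T where "T = (\<lambda>(i, k). (int (set_encode {k}) + int (set_encode (As ! i)), kill i k)) `
      (SIGMA i:{..<r}. As ! i) \<union>
    (\<lambda>(i, j). (int (set_encode (As ! i \<union> As ! j)), swap i j)) ` ({..<r} \<times> {..<r})"
  have T_hom: "v \<in> ?FG d" if "(d, v) \<in> T" for d v
  proof -
    have "swap i j \<in> ?FG (int (set_encode (As ! i \<union> As ! j)))" if "i < r" "j < r" for i j
    proof -
      have "set_encode (As ! j - As ! i) + set_encode (As ! i) = set_encode (As ! i \<union> As ! j)"
        "set_encode (As ! i - As ! j) + set_encode (As ! j) = set_encode (As ! i \<union> As ! j)"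
        using finA that set_encode_Diff_subset[of "As ! i \<union> As ! j" "As ! i"]
          set_encode_Diff_subset[of "As ! i \<union> As ! j" "As ! j"]
        by (simp_all add: Un_Diff)
      then show ?thesis
        using b_hom[of "As ! j - As ! i" i] b_hom[of "As ! i - As ! j" j] that finA
        unfolding swap_def by (intro F.M.add_homogeneous) (simp_all flip: of_nat_add)
    qed
    moreover have "kill i k \<in> ?FG (int (set_encode {k}) + int (set_encode (As ! i)))" if "i < r" for i k
      using b_hom[of "{k}" i] that by (simp add: kill_def)
    ultimately show ?thesis using that unfolding T_def by auto
  qed
  have "finite T" unfolding T_def using finA by auto
  then obtain rels where rels: "set rels = T" using finite_list by blast
  define es where "es = map fst rels"
  define us where "us = map snd rels"
  let ?E = "free_module R es" and ?EG = "free_grading G es"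
  have E: "graded_module R G ?E ?EG" by (rule graded_module_free)
  have us_len: "length us = length es" by (simp add: us_def es_def)
  have us_hom: "us ! n \<in> ?FG (es ! n)" if "n < length es" for n
    using that T_hom[of "es ! n" "us ! n"] nth_mem[of n rels] by (simp add: us_def es_def rels)
  define p where "p = linear_combination F us"
  have p: "p \<in> graded_hom R ?E ?EG F ?FG"
    unfolding p_def using us_len us_hom by (rule F.linear_combination_hom)
  have p_coord: "p (coordinate_vector R es n a) = a \<odot>\<^bsub>F\<^esub> us ! n"
    if "n < length es" "a \<in> carrier R" for n a
    unfolding p_def using us_len us_hom that by (rule F.linear_combination_coordinate_vector)
  note p_cl = graded_homD(1)[OF p] and p_add = graded_homD(2)[OF p] and p_smult = graded_homD(3)[OF p]
  have p_zero: "p \<zero>\<^bsub>?E\<^esub> = \<zero>\<^bsub>F\<^esub>" using graded_hom_zero[OF E Fm p] .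
  interpret E: graded_module R G ?E ?EG by (rule E)

  let ?W = "p ` carrier ?E"
  have W_zero: "\<zero>\<^bsub>F\<^esub> \<in> ?W" using imageI[OF E.M.zero_closed, of p] p_zero by simp
  have W_add: "v \<oplus>\<^bsub>F\<^esub> w \<in> ?W" if "v \<in> ?W" "w \<in> ?W" for v w
  proof -
    obtain v' w' where "v' \<in> carrier ?E" "v = p v'" "w' \<in> carrier ?E" "w = p w'" using \<open>v \<in> ?W\<close> \<open>w \<in> ?W\<close> by blast
    then show ?thesis using imageI[OF E.M.a_closed[of v' w'], of p] p_add[of v' w'] by simp
  qed
  have W_smult: "a \<odot>\<^bsub>F\<^esub> v \<in> ?W" if "a \<in> carrier R" "v \<in> ?W" for a v
  proof -
    obtain v' where "v' \<in> carrier ?E" "v = p v'" using \<open>v \<in> ?W\<close> by blast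
    then show ?thesis using imageI[OF E.smult_closed[of a v'], of p] p_smult[of a v'] that(1) by simp
  qed
  have W_T: "v \<in> ?W" if "(d, v) \<in> T" for d v
  proof -
    obtain n where n: "n < length rels" "rels ! n = (d, v)" using \<open>(d, v) \<in> T\<close> rels
      by (metis in_set_conv_nth)
    then have "us ! n = v" by (simp add: us_def)
    moreover have "us ! n \<in> carrier F"
      using us_hom[THEN F.M.homogeneous_closed, of n] n(1) by (simp add: es_def)
    ultimately have "p (coordinate_vector R es n \<one>) = v"
      using p_coord[of n \<one>] n F.smult_one by (simp add: es_def)
    then show ?thesis
      using imageI[OF coordinate_vector_closed[OF one_closed, of es n], of p] by simp
  qed
  have W_kill: "kill i k \<in> ?W" if "i < r" "k \<in> As ! i" for i k
    using that by (intro W_T) (auto simp: T_def)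
  have W_swap: "swap i j \<in> ?W" if "i < r" "j < r" for i j
    using that by (intro W_T) (auto simp: T_def)

  have relation_zero: "q v = \<zero>" if "(d, v) \<in> T" for d v
  proof -
    have "q (kill i k) = \<zero>" if "i < r" "k \<in> As ! i" for i k
      using that finA by (simp add: kill_def q_b e_closed e_mult)
    moreover have "q (swap i j) = \<zero>" if ij: "i < r" "j < r" for i j
    proof -
      have cl: "e (As ! j - As ! i) \<in> carrier R" "e (As ! i - As ! j) \<in> carrier R"
        using finA ij by (simp_all add: e_closed)
      have "q (swap i j) = e (As ! j - As ! i) \<otimes> e (As ! i) \<oplus> e (As ! i - As ! j) \<otimes> e (As ! j)"
        unfolding swap_def using cl ij bcl by (simp add: q_add q_b)
      also have "\<dots> = e (As ! i \<union> As ! j) \<oplus> e (As ! i \<union> As ! j)"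
        using finA ij by (simp add: e_mult Int_commute Un_commute Diff_disjoint)
      finally show ?thesis using finA ij by (simp add: double_zero e_closed)
    qed
    ultimately show ?thesis using that unfolding T_def by auto
  qed
  have W_kernel: "q v = \<zero>" if "v \<in> ?W" for v
  proof -
    obtain w where w: "w \<in> carrier ?E" "v = p w" using \<open>v \<in> ?W\<close> by blast
    have "q (p w) = \<zero>"
      using w(1)
    proof (induction rule: free_module_induct)
      case zero
      show ?case using p_zero q_zero by simp
    next
      case (coordinate n d a)
      have a: "a \<in> carrier R" using coordinate homogeneous_closed by blast
      have "(es ! n, us ! n) \<in> T"
        using coordinate(1) nth_mem[of n rels] by (simp add: us_def es_def rels)
      then have "q (us ! n) = \<zero>" by (rule relation_zero)
      moreover have "us ! n \<in> carrier F" using us_hom[THEN F.M.homogeneous_closed] coordinate(1) .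
      ultimately show ?case using p_coord[OF coordinate(1) a] q_smult[OF a] a by simp
    next
      case (add v w)
      then show ?case using p_add p_cl q_add by simp
    qed
    with w show ?thesis by simp
  qed

  define piv where "piv C = (SOME i. i < r \<and> As ! i \<subseteq> C)" for C
  have piv: "piv C < r \<and> As ! piv C \<subseteq> C" if "i < r" "As ! i \<subseteq> C" for i C
    unfolding piv_def using that by (intro someI[of "\<lambda>i. i < r \<and> As ! i \<subseteq> C"]) auto
  define \<sigma> where "\<sigma> C = b (piv C) (e (C - As ! piv C))" for C
  have \<sigma>_cl: "\<sigma> C \<in> carrier F" if "finite C" for C
    unfolding \<sigma>_def using that by (intro bcl e_closed) auto
  obtain s where s_cl: "s \<in> carrier R \<rightarrow> carrier F"
    and s_add: "\<And>x y. x \<in> carrier R \<Longrightarrow> y \<in> carrier R \<Longrightarrow> s (x \<oplus> y) = s x \<oplus>\<^bsub>F\<^esub> s y"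
    and s_hom: "\<And>d x. x \<in> G d \<Longrightarrow> s x = (if x = \<zero> then \<zero>\<^bsub>F\<^esub> else \<sigma> (set_decode (nat d)))"
  proof (rule extend_additively[OF F.M.abelian_group_axioms,
        of "\<lambda>d x. if x = \<zero> then \<zero>\<^bsub>F\<^esub> else \<sigma> (set_decode (nat d))"])
    fix d x y assume x: "x \<in> G d" and y: "y \<in> G d"
    have "x = y" if nonzero: "x \<noteq> \<zero>" "y \<noteq> \<zero>"
    proof -
      obtain A where "finite A" "int (set_encode A) = d" "x = e A"
        using x nonzero(1) by (rule homogeneousE)
      moreover obtain B where "finite B" "int (set_encode B) = d" "y = e B"
        using y nonzero(2) by (rule homogeneousE)
      ultimately show ?thesis using set_encode_eq[of A B] by simp
    qed
    then show "(if x \<oplus> y = \<zero> then \<zero>\<^bsub>F\<^esub> else \<sigma> (set_decode (nat d))) =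
      (if x = \<zero> then \<zero>\<^bsub>F\<^esub> else \<sigma> (set_decode (nat d))) \<oplus>\<^bsub>F\<^esub>
      (if y = \<zero> then \<zero>\<^bsub>F\<^esub> else \<sigma> (set_decode (nat d)))"
      using homogeneous_closed[OF x] homogeneous_closed[OF y] F_double \<sigma>_cl
      by (cases "x = \<zero>"; cases "y = \<zero>") (simp_all add: double_zero)
  qed (use \<sigma>_cl in auto)
  have s_zero: "s \<zero> = \<zero>\<^bsub>F\<^esub>" using s_hom[OF zero_homogeneous[of 0]] by simp
  have s_e: "s (e C) = \<sigma> C" if "finite C" for C
    using s_hom[OF e_homogeneous[OF that]] e_nonzero[OF that] that by simp
  have congruent: "v \<oplus>\<^bsub>F\<^esub> s (q v) \<in> ?W" if "v \<in> carrier F" for v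
    using that[unfolded F_def]
  proof (induction rule: free_module_induct)
    case zero
    then show ?case using q_zero s_zero W_zero by (simp flip: F_def)
  next
    case (coordinate i d a)
    then have i: "i < r" by (simp add: len)
    have "b i a \<oplus>\<^bsub>F\<^esub> s (q (b i a)) \<in> ?W"
    proof (cases "a = \<zero>")
      case True
      then show ?thesis using q_zero s_zero W_zero by (simp add: b_zero)
    next
      case False
      with coordinate(2) obtain B where B: "finite B" "a = e B" by (rule homogeneousE)
      have qb: "q (b i a) = e B \<otimes> e (As ! i)" using q_b i B e_closed by simp
      show ?thesis
      proof (cases "B \<inter> As ! i = {}")
        case False
        then obtain k where k: "k \<in> B" "k \<in> As ! i" by blast
        have "b i a = e (B - {k}) \<odot>\<^bsub>F\<^esub> kill i k"
          using B k(1) by (simp add: kill_def b_smult e_closed e_mult insert_absorb)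
        then have "b i a \<in> ?W" using W_smult W_kill i k(2) B e_closed by simp
        moreover have "q (b i a) = \<zero>" using qb False B finA[OF i] by (simp add: e_mult)
        ultimately show ?thesis using s_zero bcl B e_closed by simp
      next
        case True
        define C where "C = B \<union> As ! i"
        define j where "j = piv C"
        have C: "finite C" "B = C - As ! i" "As ! i \<subseteq> C" using True B finA[OF i] by (auto simp: C_def)
        have j: "j < r" "As ! j \<subseteq> C" using piv[OF i C(3)] by (auto simp: j_def)
        let ?D = "C - (As ! i \<union> As ! j)"
        have D: "?D \<inter> (As ! j - As ! i) = {}" "?D \<union> (As ! j - As ! i) = C - As ! i"
          "?D \<inter> (As ! i - As ! j) = {}" "?D \<union> (As ! i - As ! j) = C - As ! j"
          using C j by auto
        have eD: "e ?D \<in> carrier R" "e (As ! j - As ! i) \<in> carrier R" "e (As ! i - As ! j) \<in> carrier R"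
          using C finA i j by (simp_all add: e_closed)
        have "e ?D \<odot>\<^bsub>F\<^esub> swap i j = b i (e (C - As ! i)) \<oplus>\<^bsub>F\<^esub> b j (e (C - As ! j))"
          unfolding swap_def using eD C(1) finA i j D
          by (simp add: F.smult_r_distr bcl b_smult e_mult)
        also have "\<dots> = b i a \<oplus>\<^bsub>F\<^esub> s (q (b i a))"
        proof -
          have "q (b i a) = e C" using qb True B(1) finA[OF i] by (simp add: e_mult C_def)
          moreover have "a = e (C - As ! i)" using B(2) C(2) by simp
          ultimately show ?thesis using s_e[OF C(1)] by (simp add: \<sigma>_def j_def)
        qed
        finally show ?thesis using W_smult W_swap i j eD by metis
      qed
    qed
    then show ?case by (simp add: b_def)
  next
    case (add v w)
    note vw = add.hyps[folded F_def]
    have sq: "s (q v) \<in> carrier F" "s (q w) \<in> carrier F" "q v \<in> carrier R" "q w \<in> carrier R"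
      using vw q_cl s_cl I.Icarr by auto
    have "(v \<oplus>\<^bsub>F\<^esub> w) \<oplus>\<^bsub>F\<^esub> s (q (v \<oplus>\<^bsub>F\<^esub> w)) = (v \<oplus>\<^bsub>F\<^esub> s (q v)) \<oplus>\<^bsub>F\<^esub> (w \<oplus>\<^bsub>F\<^esub> s (q w))"
      using vw sq by (simp add: q_add s_add F.M.a_ac)
    then show ?case using W_add add.IH by (simp add: F_def)
  qed

  have kernel: "?W = {v \<in> carrier F. q v = \<zero>}"
  proof (intro equalityI subsetI)
    fix v assume v: "v \<in> {v \<in> carrier F. q v = \<zero>}"
    then show "v \<in> ?W" using congruent[of v] s_zero by simp
  qed (use W_kernel p_cl in auto)

  have "I \<subseteq> q ` carrier F"
    unfolding I_def
  proof (rule genideal_minimal)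
    have mult: "a \<otimes> x \<in> q ` carrier F" if "a \<in> carrier R" "x \<in> q ` carrier F" for a x
    proof -
      obtain v where "v \<in> carrier F" "x = q v" using \<open>x \<in> q ` carrier F\<close> by blast
      then show ?thesis using imageI[OF F.smult_closed[of a v], of q] q_smult[of a v] that(1) by simp
    qed
    have cl: "x \<in> carrier R" if "x \<in> q ` carrier F" for x
      using that q_cl I.Icarr by blast
    have "additive_subgroup (q ` carrier F) R"
    proof (rule additive_subgroup_of_closed)
      show "\<zero> \<in> q ` carrier F" using imageI[OF F.M.zero_closed, of q] q_zero by simp
      show "x \<oplus> y \<in> q ` carrier F" if "x \<in> q ` carrier F" "y \<in> q ` carrier F" for x y
      proof -
        obtain v w where "v \<in> carrier F" "x = q v" "w \<in> carrier F" "y = q w" using \<open>x \<in> _\<close> \<open>y \<in> _\<close> by blast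
        then show ?thesis using imageI[OF F.M.a_closed[of v w], of q] q_add[of v w] by simp
      qed
      show "\<exists>y\<in>q ` carrier F. y \<oplus> x = \<zero>" if "x \<in> q ` carrier F" for x
        using that cl double_zero by blast
    qed (use cl in blast)
    then show "ideal (q ` carrier F) R"
      using mult cl m_comm
      by (intro idealI ring_axioms) (auto dest: additive_subgroup.a_subgroup)
    show "e ` set As \<subseteq> q ` carrier F"
    proof
      fix x assume "x \<in> e ` set As"
      then obtain i where i: "i < r" "x = e (As ! i)" by (auto simp: in_set_conv_nth r_def)
      then have "q (b i \<one>) = x" using q_b e_closed finA by simp
      then show "x \<in> q ` carrier F" using bcl[of \<one> i] by auto
    qed
  qed
  then have image: "q ` carrier F = carrier ?M" using q_cl by auto
  show ?thesis
    unfolding finitely_presented_def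
  proof (intro conjI exI)
    show "graded_module R G ?M ?H" by (rule M)
    show "p \<in> graded_hom R ?E ?EG (free_module R ds) ?FG" using p by (simp add: F_def)
    show "q \<in> graded_hom R (free_module R ds) ?FG ?M ?H" using q by (simp add: F_def)
    show "p ` carrier ?E = {v \<in> carrier (free_module R ds). q v = \<zero>\<^bsub>?M\<^esub>}"
      using kernel by (simp add: F_def)
    show "q ` carrier (free_module R ds) = carrier ?M" using image by (simp add: F_def)
  qed
qed

text \<open>Non-zero homogeneous generators are monomials, and zero can be dropped from the generators.\<close>

theorem coherent: "graded_coherent R G"
  unfolding graded_coherent_def
proof (intro conjI allI impI)
  fix S assume S: "finite S \<and> S \<subseteq> (\<Union>d. G d)"
  then have "\<exists>A. finite A \<and> x = e A" if "x \<in> S - {\<zero>}" for x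
    using that homogeneousE by (metis DiffE UN_E insertCI subsetD)
  then obtain A where A: "\<And>x. x \<in> S - {\<zero>} \<Longrightarrow> finite (A x) \<and> x = e (A x)" by metis
  obtain As where As: "set As = A ` (S - {\<zero>})" using S finite_list[of "A ` (S - {\<zero>})"] by auto
  have eA: "e ` set As = S - {\<zero>}" using A unfolding As by force
  have Scl: "S \<subseteq> carrier R" using S homogeneous_closed by blast
  have "Idl (S - {\<zero>}) = Idl S"
  proof
    have "ideal (Idl (S - {\<zero>})) R" using Scl by (intro genideal_ideal) auto
    moreover from this have "S \<subseteq> Idl (S - {\<zero>})"
      using genideal_self[of "S - {\<zero>}"] Scl additive_subgroup.zero_closed ideal.axioms(1) by blast
    ultimately show "Idl S \<subseteq> Idl (S - {\<zero>})" by (rule genideal_minimal)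
    show "Idl (S - {\<zero>}) \<subseteq> Idl S"
      using genideal_self[OF Scl] by (intro genideal_minimal genideal_ideal Scl) auto
  qed
  moreover have "finite B" if "B \<in> set As" for B using that A unfolding As by blast
  ultimately show "finitely_presented R G (ideal_module R (Idl S)) (\<lambda>d. Idl S \<inter> G d)"
    using monomial_ideal_finitely_presented[of As] by (simp add: eA)
qed (rule graded_ring_axioms)

end

section \<open>The quotient of the polynomial ring by the squares\<close>

lemma poly_F2_simps [simp]:
  "carrier poly_F2 = UNIV" "x \<otimes>\<^bsub>poly_F2\<^esub> y = x * y" "x \<oplus>\<^bsub>poly_F2\<^esub> y = x + y"
  "\<one>\<^bsub>poly_F2\<^esub> = 1" "\<zero>\<^bsub>poly_F2\<^esub> = 0"
  by (simp_all add: ring_of_type_algebra_def)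

lemma poly_F2_double: "p + p = 0" for p :: f2_poly
proof (rule poly_mapping_eqI)
  have "b + b = 0" for b :: bit by (cases b) simp_all
  then show "Poly_Mapping.lookup (p + p) m = Poly_Mapping.lookup 0 m" for m
    by (simp only: lookup_add lookup_zero)
qed

lemma poly_F2_sum_monomials:
  "p = (\<Sum>m\<in>Poly_Mapping.keys p. Poly_Mapping.single m (Poly_Mapping.lookup p m))" for p :: f2_poly
  by (rule poly_mapping_eqI)
    (auto simp: lookup_sum lookup_single when_def in_keys_iff sum.delta)

lemma squares_ideal_ideal: "ideal squares_ideal poly_F2"
  unfolding squares_ideal_def by (intro ring.genideal_ideal ring_from_type_algebra) simp

text \<open>
  The polynomials described on the right form an ideal which contains the squares; conversely,
  their monomials are multiples of squares.
\<close>

lemma mem_squares_ideal_iff: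
  "p \<in> squares_ideal \<longleftrightarrow> (\<forall>m\<in>Poly_Mapping.keys p. \<exists>i. 2 \<le> Poly_Mapping.lookup m i)"
proof
  interpret P: ring poly_F2 by (rule ring_from_type_algebra)
  interpret J: ideal squares_ideal poly_F2 by (rule squares_ideal_ideal)
  let ?K = "{p :: f2_poly. \<forall>m\<in>Poly_Mapping.keys p. \<exists>i. 2 \<le> Poly_Mapping.lookup m i}"
  have var_sq: "poly_var i ^ 2 = Poly_Mapping.single (Poly_Mapping.single i 2) 1" for i
    by (simp add: poly_var_def power2_eq_square mult_single numeral_2_eq_2 flip: single_add)
  have mult: "a * p \<in> ?K" if p: "p \<in> ?K" for a p :: f2_poly
  proof -
    have "\<exists>i. 2 \<le> Poly_Mapping.lookup m i" if m: "m \<in> Poly_Mapping.keys (a * p)" for m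
    proof -
      obtain k l where "m = k + l" "l \<in> Poly_Mapping.keys p"
        using m keys_mult[of a p] by blast
      moreover obtain i where "2 \<le> Poly_Mapping.lookup l i" using p calculation(2) by blast
      ultimately have "2 \<le> Poly_Mapping.lookup m i" by (simp add: lookup_add)
      then show ?thesis ..
    qed
    then show ?thesis by simp
  qed
  have "additive_subgroup ?K poly_F2"
  proof (rule P.additive_subgroup_of_closed)
    show "x \<oplus>\<^bsub>poly_F2\<^esub> y \<in> ?K" if "x \<in> ?K" "y \<in> ?K" for x y
      using that keys_add[of x y] by auto
    show "\<exists>y\<in>?K. y \<oplus>\<^bsub>poly_F2\<^esub> x = \<zero>\<^bsub>poly_F2\<^esub>" if "x \<in> ?K" for x
      using that poly_F2_double[of x] by (intro bexI[of _ x]) simp_all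
  qed simp_all
  then have "ideal ?K poly_F2"
  proof (intro idealI ring_from_type_algebra additive_subgroup.a_subgroup)
    show "x \<otimes>\<^bsub>poly_F2\<^esub> a \<in> ?K" "a \<otimes>\<^bsub>poly_F2\<^esub> x \<in> ?K"
      if "a \<in> ?K" "x \<in> carrier poly_F2" for a x
      using mult[OF that(1), of x] by (simp_all add: mult.commute)
  qed
  moreover have "{poly_var i ^ 2 |i. True} \<subseteq> ?K"
  proof
    fix p assume "p \<in> {poly_var i ^ 2 |i. True}"
    then obtain i where "p = Poly_Mapping.single (Poly_Mapping.single i 2) 1" using var_sq by auto
    then show "p \<in> ?K" by (auto intro!: exI[of _ i])
  qed
  ultimately have sub: "squares_ideal \<subseteq> ?K" unfolding squares_ideal_def by (rule P.genideal_minimal)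
  show "\<forall>m\<in>Poly_Mapping.keys p. \<exists>i. 2 \<le> Poly_Mapping.lookup m i" if "p \<in> squares_ideal"
    using sub that by blast
  assume p: "\<forall>m\<in>Poly_Mapping.keys p. \<exists>i. 2 \<le> Poly_Mapping.lookup m i"
  have monomial: "Poly_Mapping.single m c \<in> squares_ideal" if "2 \<le> Poly_Mapping.lookup m i" for m i c
  proof -
    define l where "l = m - Poly_Mapping.single i 2"
    have "m = l + Poly_Mapping.single i 2"
      using that by (intro poly_mapping_eqI)
        (auto simp: l_def lookup_add lookup_minus lookup_single when_def)
    then have "Poly_Mapping.single m c = Poly_Mapping.single l c * poly_var i ^ 2"
      by (simp add: var_sq mult_single)
    moreover have "poly_var i ^ 2 \<in> squares_ideal"
      unfolding squares_ideal_def using P.genideal_self[of "{poly_var i ^ 2 |i. True}"] by auto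
    ultimately show ?thesis using J.I_l_closed[of "poly_var i ^ 2" "Poly_Mapping.single l c"] by simp
  qed
  have "(\<Sum>m\<in>K. Poly_Mapping.single m (Poly_Mapping.lookup p m)) \<in> squares_ideal"
    if "K \<subseteq> Poly_Mapping.keys p" for K
    using finite_subset[OF that finite_keys] that
  proof (induction K rule: finite_induct)
    case empty
    then show ?case using additive_subgroup.zero_closed[OF J.is_additive_subgroup] by simp
  next
    case (insert m K)
    then obtain i where "2 \<le> Poly_Mapping.lookup m i" using p by blast
    from monomial[OF this] insert show ?case
      using additive_subgroup.a_closed[OF J.is_additive_subgroup, of "Poly_Mapping.single m (Poly_Mapping.lookup p m)"] by simp
  qed
  from this[OF order_refl] show "p \<in> squares_ideal" using poly_F2_sum_monomials[of p] by simp
qed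

definition square_free :: "nat set \<Rightarrow> nat \<Rightarrow>\<^sub>0 nat" where
  "square_free A = (\<Sum>i\<in>A. Poly_Mapping.single i 1)"

lemma lookup_square_free:
  "finite A \<Longrightarrow> Poly_Mapping.lookup (square_free A) i = (if i \<in> A then 1 else 0)"
  by (simp add: square_free_def lookup_sum lookup_single when_def)

lemma keys_square_free: "finite A \<Longrightarrow> Poly_Mapping.keys (square_free A) = A"
  by (simp add: set_eq_iff in_keys_iff lookup_square_free)

lemma square_free_Un:
  "finite A \<Longrightarrow> finite B \<Longrightarrow> A \<inter> B = {} \<Longrightarrow> square_free (A \<union> B) = square_free A + square_free B"
  by (simp add: square_free_def sum.union_disjoint)

lemma monomial_degree_square_free:
  assumes "finite A"
  shows "monomial_degree (square_free A) = int (set_encode A)"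
  unfolding monomial_degree_def keys_square_free[OF assms]
  by (simp add: lookup_square_free[OF assms] set_encode_def)

lemma square_freeI:
  assumes "\<And>i. Poly_Mapping.lookup m i < 2"
  shows "m = square_free (Poly_Mapping.keys m)"
proof (rule poly_mapping_eqI)
  fix i
  show "Poly_Mapping.lookup m i = Poly_Mapping.lookup (square_free (Poly_Mapping.keys m)) i"
    using assms[of i] by (auto simp: lookup_square_free in_keys_iff)
qed

definition residue :: "f2_poly \<Rightarrow> f2_poly set" where
  "residue p = squares_ideal +>\<^bsub>poly_F2\<^esub> p"

definition exterior_basis :: "nat set \<Rightarrow> f2_poly set" where
  "exterior_basis A = residue (Poly_Mapping.single (square_free A) 1)"

lemma exterior_simps:
  "carrier exterior = range residue"
  "\<zero>\<^bsub>exterior\<^esub> = residue 0" "\<one>\<^bsub>exterior\<^esub> = residue 1"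
  "residue p \<oplus>\<^bsub>exterior\<^esub> residue q = residue (p + q)"
  "residue p \<otimes>\<^bsub>exterior\<^esub> residue q = residue (p * q)"
proof -
  interpret J: ideal squares_ideal poly_F2 by (rule squares_ideal_ideal)
  show "carrier exterior = range residue"
    by (auto simp: exterior_def FactRing_def A_RCOSETS_def' residue_def)
  show "\<zero>\<^bsub>exterior\<^esub> = residue 0"
    using J.a_rcos_const[OF additive_subgroup.zero_closed[OF J.is_additive_subgroup]] by (simp add: exterior_def FactRing_def residue_def)
  show "\<one>\<^bsub>exterior\<^esub> = residue 1"
    by (simp add: exterior_def FactRing_def residue_def)
  show "residue p \<oplus>\<^bsub>exterior\<^esub> residue q = residue (p + q)"
    using J.a_rcos_sum[of p q] by (simp add: exterior_def FactRing_def residue_def)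
  show "residue p \<otimes>\<^bsub>exterior\<^esub> residue q = residue (p * q)"
    using J.rcoset_mult_add[of p q] by (simp add: exterior_def FactRing_def residue_def)
qed

lemma residue_eq_iff: "residue p = residue q \<longleftrightarrow> p + q \<in> squares_ideal"
proof -
  interpret J: ideal squares_ideal poly_F2 by (rule squares_ideal_ideal)
  have mem: "x \<in> residue q \<longleftrightarrow> x + q \<in> squares_ideal" for x q
  proof -
    have cancel: "(h + q) + q = h" for h
      using poly_F2_double[of q] by (simp only: add.assoc add_0_right)
    then have "x = h + q \<longleftrightarrow> h = x + q" for h by metis
    then show ?thesis by (auto simp: residue_def a_r_coset_def')
  qed
  show ?thesis
  proof
    have "p \<in> residue p" using mem[of p p] poly_F2_double[of p] additive_subgroup.zero_closed[OF J.is_additive_subgroup] by simp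
    then show "residue p = residue q \<Longrightarrow> p + q \<in> squares_ideal" using mem[of p q] by simp
    assume pq: "p + q \<in> squares_ideal"
    then have "p \<in> squares_ideal +>\<^bsub>poly_F2\<^esub> q" using mem[of p q] by (simp add: residue_def)
    then show "residue p = residue q"
      using J.a_repr_independence[of p squares_ideal q] J.a_subgroup by (simp add: residue_def)
  qed
qed

lemma residue_zero_iff: "residue p = \<zero>\<^bsub>exterior\<^esub> \<longleftrightarrow> p \<in> squares_ideal"
  by (simp add: exterior_simps residue_eq_iff)

text \<open>
  The choice of representative does not matter, since polynomials in the ideal have no square-free
  monomials.
\<close>

definition residue_coeff :: "nat set \<Rightarrow> f2_poly set \<Rightarrow> bit" where
  "residue_coeff A x = Poly_Mapping.lookup (SOME p. residue p = x) (square_free A)"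

lemma residue_coeff:
  assumes A: "finite A"
  shows "residue_coeff A (residue p) = Poly_Mapping.lookup p (square_free A)"
proof -
  define q where "q = (SOME q. residue q = residue p)"
  have "residue q = residue p" unfolding q_def by (rule someI[of _ p]) simp
  then have "q + p \<in> squares_ideal" by (simp add: residue_eq_iff)
  moreover have "\<not> 2 \<le> Poly_Mapping.lookup (square_free A) i" for i
    using A by (simp add: lookup_square_free)
  ultimately have "square_free A \<notin> Poly_Mapping.keys (q + p)"
    unfolding mem_squares_ideal_iff by blast
  then have "Poly_Mapping.lookup q (square_free A) + Poly_Mapping.lookup p (square_free A) = 0"
    by (simp add: in_keys_iff lookup_add)
  then have "Poly_Mapping.lookup q (square_free A) = Poly_Mapping.lookup p (square_free A)"
    by (cases "Poly_Mapping.lookup q (square_free A)";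
        cases "Poly_Mapping.lookup p (square_free A)") simp_all
  then show ?thesis by (simp add: residue_coeff_def q_def)
qed

lemma residue_coeff_basis:
  assumes "finite A" "finite B"
  shows "residue_coeff A (exterior_basis B) = (if A = B then 1 else 0)"
proof -
  have "square_free B = square_free A \<longleftrightarrow> B = A"
    using keys_square_free assms by metis
  then show ?thesis
    using assms by (auto simp: exterior_basis_def residue_coeff lookup_single when_def)
qed

lemma exterior_grading_eq:
  "exterior_grading d =
    insert \<zero>\<^bsub>exterior\<^esub> {exterior_basis A | A. finite A \<and> int (set_encode A) = d}"
proof (intro equalityI subsetI)
  fix x assume "x \<in> exterior_grading d"
  then obtain p where p: "p \<in> poly_grading d" "x = residue p"
    by (auto simp: exterior_grading_def quotient_grading_def residue_def)
  show "x \<in> insert \<zero>\<^bsub>exterior\<^esub> {exterior_basis A | A. finite A \<and> int (set_encode A) = d}"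
  proof (cases "p \<in> squares_ideal")
    case True
    then show ?thesis using p residue_zero_iff by simp
  next
    case False
    \<comment> \<open>The degree determines the square-free monomial, so all other monomials of \<open>p\<close> are in the ideal.\<close>
    then obtain m where m: "m \<in> Poly_Mapping.keys p" "\<And>i. Poly_Mapping.lookup m i < 2"
      by (force simp: mem_squares_ideal_iff not_le)
    define A where "A = Poly_Mapping.keys m"
    have A: "finite A" "m = square_free A" unfolding A_def using square_freeI m(2) by auto
    have deg: "int (set_encode A) = d"
      using p(1) m(1) A monomial_degree_square_free by (auto simp: poly_grading_def)
    have "\<exists>i. 2 \<le> Poly_Mapping.lookup l i"
      if l: "l \<in> Poly_Mapping.keys (p + Poly_Mapping.single m 1)" for l
    proof (rule ccontr)
      assume "\<nexists>i. 2 \<le> Poly_Mapping.lookup l i"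
      then have sf: "l = square_free (Poly_Mapping.keys l)"
        using square_freeI[of l] by (simp add: not_le)
      have "Poly_Mapping.lookup p m = 1"
        using m(1) by (cases "Poly_Mapping.lookup p m") (auto simp: in_keys_iff)
      then have "l \<noteq> m" using l by (auto simp: in_keys_iff lookup_add)
      then have "l \<in> Poly_Mapping.keys p"
        using l by (auto simp: in_keys_iff lookup_add lookup_single when_def)
      then have "monomial_degree l = d" using p(1) by (simp add: poly_grading_def)
      then have "int (set_encode (Poly_Mapping.keys l)) = d"
        using monomial_degree_square_free[of "Poly_Mapping.keys l"] sf by simp
      then have "Poly_Mapping.keys l = A" using deg set_encode_eq[of "Poly_Mapping.keys l" A] A by simp
      then show False using \<open>l \<noteq> m\<close> sf A by simp
    qed
    then have "p + Poly_Mapping.single m 1 \<in> squares_ideal" by (simp add: mem_squares_ideal_iff)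
    then have "x = exterior_basis A"
      using p(2) A by (simp add: exterior_basis_def residue_eq_iff)
    then show ?thesis using A deg by blast
  qed
next
  fix x assume "x \<in> insert \<zero>\<^bsub>exterior\<^esub> {exterior_basis A | A. finite A \<and> int (set_encode A) = d}"
  then consider "x = residue 0" | A where "finite A" "int (set_encode A) = d" "x = exterior_basis A"
    by (auto simp: exterior_simps)
  then show "x \<in> exterior_grading d"
  proof cases
    case 1
    then show ?thesis
      by (auto simp: exterior_grading_def quotient_grading_def residue_def poly_grading_def)
  next
    case 2
    then have "Poly_Mapping.single (square_free A) 1 \<in> poly_grading d"
      by (simp add: poly_grading_def monomial_degree_square_free)
    then show ?thesis
      using 2 by (auto simp: exterior_grading_def quotient_grading_def residue_def exterior_basis_def)
  qed
qed

lemma exterior_binary_exterior_algebra: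
  "binary_exterior_algebra exterior exterior_grading exterior_basis"
proof -
  interpret J: ideal squares_ideal poly_F2 by (rule squares_ideal_ideal)
  interpret E: cring exterior
    unfolding exterior_def by (rule J.quotient_is_cring) (rule cring_from_type_algebra)
  have double: "x \<oplus>\<^bsub>exterior\<^esub> x = \<zero>\<^bsub>exterior\<^esub>" if "x \<in> carrier exterior" for x
    using that by (auto simp: exterior_simps poly_F2_double)
  have basis_closed: "exterior_basis A \<in> carrier exterior" for A
    by (simp add: exterior_simps exterior_basis_def)
  have homogeneous_closed: "exterior_grading d \<subseteq> carrier exterior" for d
    using basis_closed by (auto simp: exterior_grading_eq)
  have same_degree: "x = y"
    if xy: "x \<in> exterior_grading d" "y \<in> exterior_grading d"
      "x \<noteq> \<zero>\<^bsub>exterior\<^esub>" "y \<noteq> \<zero>\<^bsub>exterior\<^esub>" for x y d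
  proof -
    obtain A where A: "finite A" "int (set_encode A) = d" "x = exterior_basis A"
      using xy(1,3) unfolding exterior_grading_eq by blast
    obtain B where B: "finite B" "int (set_encode B) = d" "y = exterior_basis B"
      using xy(2,4) unfolding exterior_grading_eq by blast
    have "A = B" using A(1,2) B(1,2) set_encode_eq[of A B] by simp
    then show ?thesis using A B by simp
  qed
  have coeff_zero: "residue_coeff A \<zero>\<^bsub>exterior\<^esub> = 0" if "finite A" for A
    using that by (simp add: exterior_simps residue_coeff)
  have coeff_add: "residue_coeff A (x \<oplus>\<^bsub>exterior\<^esub> y) = residue_coeff A x + residue_coeff A y"
    if "finite A" "x \<in> carrier exterior" "y \<in> carrier exterior" for A x y
    using that by (auto simp: exterior_simps residue_coeff lookup_add)
  define \<pi> where "\<pi> d x = (if 0 \<le> d \<and> residue_coeff (set_decode (nat d)) x = 1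
    then exterior_basis (set_decode (nat d)) else \<zero>\<^bsub>exterior\<^esub>)" for d x
  have direct_sum: "direct_sum_grading exterior exterior_grading"
  proof (rule direct_sum_gradingI[where \<pi> = \<pi>])
    show "abelian_group exterior" by unfold_locales
    show "additive_subgroup (exterior_grading d) exterior" for d
    proof (rule E.additive_subgroup_of_closed[OF homogeneous_closed])
      show zero: "\<zero>\<^bsub>exterior\<^esub> \<in> exterior_grading d" by (simp add: exterior_grading_eq)
      show "x \<oplus>\<^bsub>exterior\<^esub> y \<in> exterior_grading d"
        if x: "x \<in> exterior_grading d" and y: "y \<in> exterior_grading d" for x y
      proof -
        have cl: "x \<in> carrier exterior" "y \<in> carrier exterior" using x y homogeneous_closed by auto
        have "x = \<zero>\<^bsub>exterior\<^esub> \<or> y = \<zero>\<^bsub>exterior\<^esub> \<or> x = y" using same_degree x y by blast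
        then show ?thesis using x y zero cl double[of y] by auto
      qed
      show "\<exists>y\<in>exterior_grading d. y \<oplus>\<^bsub>exterior\<^esub> x = \<zero>\<^bsub>exterior\<^esub>" if "x \<in> exterior_grading d" for x
        using that double homogeneous_closed by blast
    qed
    show "\<pi> d x \<in> exterior_grading d" for d x
      by (auto simp: \<pi>_def exterior_grading_eq)
    show "\<pi> d (x \<oplus>\<^bsub>exterior\<^esub> y) = \<pi> d x \<oplus>\<^bsub>exterior\<^esub> \<pi> d y"
      if "x \<in> carrier exterior" "y \<in> carrier exterior" for x y d
    proof -
      have "b = 0 \<or> b = 1" for b :: bit by (cases b) simp_all
      then show ?thesis
        using that basis_closed double
        by (auto simp: \<pi>_def coeff_add)
    qed
    show "\<pi> d x = (if d = e then x else \<zero>\<^bsub>exterior\<^esub>)" if x: "x \<in> exterior_grading e" for x d e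
    proof (cases "x = \<zero>\<^bsub>exterior\<^esub>")
      case True
      then show ?thesis by (simp add: \<pi>_def coeff_zero)
    next
      case False
      then obtain A where A: "finite A" "int (set_encode A) = e" "x = exterior_basis A"
        using x by (auto simp: exterior_grading_eq)
      have "0 \<le> d \<and> set_decode (nat d) = A \<longleftrightarrow> d = e"
        using A(1,2) by (auto simp: nat_eq_iff)
      then show ?thesis
        using A by (auto simp: \<pi>_def residue_coeff_basis)
    qed
    fix P x
    assume x: "x \<in> carrier exterior" and hom: "\<And>d x. x \<in> exterior_grading d \<Longrightarrow> P x"
      and add: "\<And>x y. x \<in> carrier exterior \<Longrightarrow> y \<in> carrier exterior \<Longrightarrow> P x \<Longrightarrow> P y \<Longrightarrow>
        P (x \<oplus>\<^bsub>exterior\<^esub> y)"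
    obtain p where p: "x = residue p" using x by (auto simp: exterior_simps)
    have monomial: "P (residue (Poly_Mapping.single m c))" for m c
      by (rule hom[of _ "monomial_degree m"])
        (auto simp: exterior_grading_def quotient_grading_def residue_def poly_grading_def)
    have "P (residue (\<Sum>m\<in>K. Poly_Mapping.single m (Poly_Mapping.lookup p m)))" if "finite K" for K
      using that
    proof (induction K rule: finite_induct)
      case empty
      then show ?case using monomial[of 0 0] by simp
    next
      case (insert m K)
      let ?r = "\<Sum>m\<in>K. Poly_Mapping.single m (Poly_Mapping.lookup p m)"
      have "P (residue (Poly_Mapping.single m (Poly_Mapping.lookup p m)) \<oplus>\<^bsub>exterior\<^esub> residue ?r)"
        using insert monomial by (intro add) (simp_all add: exterior_simps)
      then show ?case using insert by (simp add: exterior_simps)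
    qed
    from this[OF finite_keys[of p]] show "P x"
      using p poly_F2_sum_monomials[of p] by simp
  qed
  show ?thesis
  proof unfold_locales
    show "exterior_basis A \<otimes>\<^bsub>exterior\<^esub> exterior_basis B =
      (if A \<inter> B = {} then exterior_basis (A \<union> B) else \<zero>\<^bsub>exterior\<^esub>)"
      if fin: "finite A" "finite B" for A B
    proof -
      have prod: "exterior_basis A \<otimes>\<^bsub>exterior\<^esub> exterior_basis B =
        residue (Poly_Mapping.single (square_free A + square_free B) 1)"
        by (simp add: exterior_basis_def exterior_simps mult_single)
      show ?thesis
      proof (cases "A \<inter> B = {}")
        case True
        then show ?thesis using fin prod by (simp add: exterior_basis_def square_free_Un)
      next
        case False
        then obtain i where "i \<in> A" "i \<in> B" by blast
        then have "2 \<le> Poly_Mapping.lookup (square_free A + square_free B) i"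
          using fin by (simp add: lookup_add lookup_square_free)
        then have "Poly_Mapping.single (square_free A + square_free B) 1 \<in> squares_ideal"
          by (auto simp: mem_squares_ideal_iff)
        then show ?thesis using False prod residue_zero_iff by simp
      qed
    qed
    show "exterior_basis {} = \<one>\<^bsub>exterior\<^esub>"
      by (simp add: exterior_basis_def exterior_simps square_free_def)
    show "exterior_basis A \<noteq> \<zero>\<^bsub>exterior\<^esub>" if "finite A" for A
      using that residue_coeff_basis[of A A] coeff_zero[of A] by auto
  qed (use direct_sum double exterior_grading_eq in auto)
qed

theorem proposition1p5:
  shows "graded_self_injective TYPE('m) TYPE('n) exterior exterior_grading \<and>
    graded_coherent exterior exterior_grading \<and>
    (\<exists>h. h \<in> graded_ring_iso
      (exterior Quot nilradical exterior)
      (quotient_grading exterior (nilradical exterior) exterior_grading)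
      F2 (concentrated_grading F2))"
proof -
  interpret binary_exterior_algebra exterior exterior_grading exterior_basis
    by (rule exterior_binary_exterior_algebra)
  show ?thesis using self_injective coherent reduced_quotient by blast
qed

end
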